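(* Let $\mathcal{H}$ be a Hopf algebra with bijective antipode over a field $k$ of characteristic zero, let $B$ be any left $\mathcal{H}$-algebra and let $A$ be a Yetter-Drinfeld $\mathcal{H}$-algebra. Then $A\otimes B$, with multiplication $$(a\otimes b)(c\otimes d)=ac_{<0>}\otimes(c_{<1>}\cdot b)d$$ and diagonal $\mathcal{H}$-action $$h\cdot(a\otimes b)=h^{(0)}\cdot a\otimes h^{(1)}\cdot b,$$ is a left $\mathcal{H}$-algebra.
   Context: Sweedler notation: $\Delta h=h^{(0)}\otimes h^{(1)}$; $S,\epsilon$ are antipode and counit. Algebras are associative and unital. A left $\mathcal{H}$-algebra is an algebra $A$ that is a left $\mathcal{H}$-module with $h\cdot(ab)=(h^{(0)}\cdot a)(h^{(1)}\cdot b)$, $h\cdot1=\epsilon(h)1$. A Yetter-Drinfeld $\mathcal{H}$-algebra is an algebra $A$ that is (1) a left $\mathcal{H}$-algebra; (2) a right $\mathcal{H}^{op}$-comodule algebra, i.e. there is a right coaction $\rho:A\to A\otimes\mathcal{H}$, $\rho(a)=a_{<0>}\otimes a_{<1>}$, with $\rho(ab)=a_{<0>}b_{<0>}\otimes b_{<1>}a_{<1>}$ and $\rho(1)=1\otimes1$; (3) satisfying $(h^{(1)}\cdot a)_{<0>}\otimes(h^{(1)}\cdot a)_{<1>}h^{(0)}=h^{(0)}\cdot a_{<0>}\otimes h^{(1)}a_{<1>}$ for all $h\in\mathcal{H}$, $a\in A$. *)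

theory Defs
  imports "HOL-Algebra.Module" "HOL-Algebra.AbelCoset"
begin

section \<open>Tensor products over a commutative ring\<close>

text \<open>
  Elements of the free module on \<open>S\<close> are finitely supported functions vanishing outside \<open>S\<close>.
  Only the module part of the records \<open>free_mod\<close> and \<open>tensor_mod\<close> is meaningful.
\<close>

definition free_mod :: "('k, 'x) ring_scheme \<Rightarrow> 'i set \<Rightarrow> ('k, 'i \<Rightarrow> 'k) module" where
  "free_mod K S =
    \<lparr>carrier = {f. (\<forall>i. f i \<in> carrier K) \<and> finite {i. f i \<noteq> \<zero>\<^bsub>K\<^esub>} \<and> (\<forall>i. i \<notin> S \<longrightarrow> f i = \<zero>\<^bsub>K\<^esub>)},
     mult = (\<lambda>_ _. undefined),
     one = undefined,
     zero = (\<lambda>_. \<zero>\<^bsub>K\<^esub>),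
     add = (\<lambda>f g i. f i \<oplus>\<^bsub>K\<^esub> g i),
     smult = (\<lambda>c f i. c \<otimes>\<^bsub>K\<^esub> f i)\<rparr>"

definition free_gen :: "('k, 'x) ring_scheme \<Rightarrow> 'i \<Rightarrow> 'i \<Rightarrow> 'k" where
  "free_gen K i = (\<lambda>j. if j = i then \<one>\<^bsub>K\<^esub> else \<zero>\<^bsub>K\<^esub>)"

abbreviation free_pairs ::
  "('k, 'x) ring_scheme \<Rightarrow> ('k, 'a, 'y) module_scheme \<Rightarrow> ('k, 'b, 'z) module_scheme
    \<Rightarrow> ('k, 'a \<times> 'b \<Rightarrow> 'k) module" where
  "free_pairs K M N \<equiv> free_mod K (carrier M \<times> carrier N)"

definition bilinear_relators ::
  "('k, 'x) ring_scheme \<Rightarrow> ('k, 'a, 'y) module_scheme \<Rightarrow> ('k, 'b, 'z) module_scheme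
    \<Rightarrow> ('a \<times> 'b \<Rightarrow> 'k) set" where
  "bilinear_relators K M N = (let F = free_pairs K M N; e = free_gen K in
     {e (m \<oplus>\<^bsub>M\<^esub> m', n) \<ominus>\<^bsub>F\<^esub> (e (m, n) \<oplus>\<^bsub>F\<^esub> e (m', n)) | m m' n.
        m \<in> carrier M \<and> m' \<in> carrier M \<and> n \<in> carrier N} \<union>
     {e (m, n \<oplus>\<^bsub>N\<^esub> n') \<ominus>\<^bsub>F\<^esub> (e (m, n) \<oplus>\<^bsub>F\<^esub> e (m, n')) | m n n'.
        m \<in> carrier M \<and> n \<in> carrier N \<and> n' \<in> carrier N} \<union>
     {e (c \<odot>\<^bsub>M\<^esub> m, n) \<ominus>\<^bsub>F\<^esub> c \<odot>\<^bsub>F\<^esub> e (m, n) | c m n.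
        c \<in> carrier K \<and> m \<in> carrier M \<and> n \<in> carrier N} \<union>
     {e (m, c \<odot>\<^bsub>N\<^esub> n) \<ominus>\<^bsub>F\<^esub> c \<odot>\<^bsub>F\<^esub> e (m, n) | c m n.
        c \<in> carrier K \<and> m \<in> carrier M \<and> n \<in> carrier N})"

definition tensor_rel ::
  "('k, 'x) ring_scheme \<Rightarrow> ('k, 'a, 'y) module_scheme \<Rightarrow> ('k, 'b, 'z) module_scheme
    \<Rightarrow> ('a \<times> 'b \<Rightarrow> 'k) set" where
  "tensor_rel K M N =
     \<Inter>{U. submodule U K (free_pairs K M N) \<and> bilinear_relators K M N \<subseteq> U}"

definition tensor_mod ::
  "('k, 'x) ring_scheme \<Rightarrow> ('k, 'a, 'y) module_scheme \<Rightarrow> ('k, 'b, 'z) module_scheme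
    \<Rightarrow> ('k, ('a \<times> 'b \<Rightarrow> 'k) set) module" where
  "tensor_mod K M N = (let F = free_pairs K M N; U = tensor_rel K M N in
    \<lparr>carrier = a_rcosets\<^bsub>F\<^esub> U,
     mult = (\<lambda>_ _. undefined),
     one = undefined,
     zero = U,
     add = (\<lambda>s t. s <+>\<^bsub>F\<^esub> t),
     smult = (\<lambda>c t. \<Union>f\<in>t. U +>\<^bsub>F\<^esub> (c \<odot>\<^bsub>F\<^esub> f))\<rparr>)"

definition pure_tensor ::
  "('k, 'x) ring_scheme \<Rightarrow> ('k, 'a, 'y) module_scheme \<Rightarrow> ('k, 'b, 'z) module_scheme
    \<Rightarrow> 'a \<Rightarrow> 'b \<Rightarrow> ('a \<times> 'b \<Rightarrow> 'k) set" where
  "pure_tensor K M N m n = tensor_rel K M N +>\<^bsub>free_pairs K M N\<^esub> free_gen K (m, n)"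

text \<open>
  For bilinear \<open>f\<close> with values in \<open>P\<close>, \<open>tensor_lift K P f\<close> is the linear map on the tensor product
  sending \<open>m \<otimes> n\<close> to \<open>f m n\<close>: any representative \<open>\<Sum> c\<^sub>i (m\<^sub>i, n\<^sub>i)\<close> of the coset \<open>t\<close>
  yields the same value \<open>\<Sum> c\<^sub>i f m\<^sub>i n\<^sub>i\<close>. Sweedler notation is rendered with it: an expression
  \<open>f (h\<^sup>(\<^sup>0\<^sup>)) (h\<^sup>(\<^sup>1\<^sup>))\<close> is \<open>tensor_lift K P f (\<Delta> h)\<close>.
\<close>

definition tensor_lift ::
  "('k, 'x) ring_scheme \<Rightarrow> ('k, 'c, 'y) module_scheme \<Rightarrow> ('a \<Rightarrow> 'b \<Rightarrow> 'c)
    \<Rightarrow> ('a \<times> 'b \<Rightarrow> 'k) set \<Rightarrow> 'c" where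
  "tensor_lift K P f t =
     (THE v. \<forall>x\<in>t. v = (\<Oplus>\<^bsub>P\<^esub>p\<in>{p. x p \<noteq> \<zero>\<^bsub>K\<^esub>}. x p \<odot>\<^bsub>P\<^esub> f (fst p) (snd p)))"

definition tensor_assoc ::
  "('k, 'x) ring_scheme \<Rightarrow> ('k, 'a, 'y) module_scheme \<Rightarrow> ('k, 'b, 'z) module_scheme
    \<Rightarrow> ('k, 'c, 'w) module_scheme \<Rightarrow> (('a \<times> 'b \<Rightarrow> 'k) set \<times> 'c \<Rightarrow> 'k) set
    \<Rightarrow> ('a \<times> ('b \<times> 'c \<Rightarrow> 'k) set \<Rightarrow> 'k) set" where
  "tensor_assoc K M N P =
     (let T = tensor_mod K M (tensor_mod K N P) in
      tensor_lift K T (\<lambda>s p. tensor_lift K T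
        (\<lambda>m n. pure_tensor K M (tensor_mod K N P) m (pure_tensor K N P n p)) s))"

definition tensor_alg ::
  "('k, 'x) ring_scheme \<Rightarrow> ('k, 'a, 'y) module_scheme \<Rightarrow> ('k, 'b, 'z) module_scheme
    \<Rightarrow> ('k, ('a \<times> 'b \<Rightarrow> 'k) set) module" where
  "tensor_alg K A B = (let T = tensor_mod K A B in
     T\<lparr>mult := (\<lambda>s t. tensor_lift K T (\<lambda>a b. tensor_lift K T
          (\<lambda>c d. pure_tensor K A B (a \<otimes>\<^bsub>A\<^esub> c) (b \<otimes>\<^bsub>B\<^esub> d)) t) s),
       one := pure_tensor K A B \<one>\<^bsub>A\<^esub> \<one>\<^bsub>B\<^esub>\<rparr>)"

definition lin_maps ::
  "('k, 'x) ring_scheme \<Rightarrow> ('k, 'a, 'y) module_scheme \<Rightarrow> ('k, 'b, 'z) module_scheme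
    \<Rightarrow> ('a \<Rightarrow> 'b) set" where
  "lin_maps K M N = {f \<in> carrier M \<rightarrow> carrier N.
     (\<forall>x\<in>carrier M. \<forall>y\<in>carrier M. f (x \<oplus>\<^bsub>M\<^esub> y) = f x \<oplus>\<^bsub>N\<^esub> f y) \<and>
     (\<forall>c\<in>carrier K. \<forall>x\<in>carrier M. f (c \<odot>\<^bsub>M\<^esub> x) = c \<odot>\<^bsub>N\<^esub> f x)}"

section \<open>Hopf algebras, module algebras and Yetter--Drinfeld algebras\<close>

text \<open>The library locale \<open>algebra\<close> covers commutative algebras only.\<close>

locale assoc_algebra = module K A + K?: field K + A?: ring A for K (structure) and A (structure) +
  assumes smult_mult_left:
      "\<lbrakk>c \<in> carrier K; x \<in> carrier A; y \<in> carrier A\<rbrakk>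
        \<Longrightarrow> (c \<odot>\<^bsub>A\<^esub> x) \<otimes>\<^bsub>A\<^esub> y = c \<odot>\<^bsub>A\<^esub> (x \<otimes>\<^bsub>A\<^esub> y)"
    and smult_mult_right:
      "\<lbrakk>c \<in> carrier K; x \<in> carrier A; y \<in> carrier A\<rbrakk>
        \<Longrightarrow> x \<otimes>\<^bsub>A\<^esub> (c \<odot>\<^bsub>A\<^esub> y) = c \<odot>\<^bsub>A\<^esub> (x \<otimes>\<^bsub>A\<^esub> y)"

locale hopf_algebra = assoc_algebra K H for K (structure) and H (structure) +
  fixes \<Delta> :: "'c \<Rightarrow> ('c \<times> 'c \<Rightarrow> 'a) set" and \<epsilon> :: "'c \<Rightarrow> 'a" and S :: "'c \<Rightarrow> 'c"
  assumes comult_lin: "\<Delta> \<in> lin_maps K H (tensor_mod K H H)"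
    and counit_hom: "\<epsilon> \<in> ring_hom H K"
    and counit_smult:
      "\<lbrakk>c \<in> carrier K; h \<in> carrier H\<rbrakk> \<Longrightarrow> \<epsilon> (c \<odot>\<^bsub>H\<^esub> h) = c \<otimes>\<^bsub>K\<^esub> \<epsilon> h"
    and comult_coassoc:
      "h \<in> carrier H \<Longrightarrow>
        tensor_assoc K H H H
          (tensor_lift K (tensor_mod K (tensor_mod K H H) H)
             (\<lambda>x y. pure_tensor K (tensor_mod K H H) H (\<Delta> x) y) (\<Delta> h)) =
        tensor_lift K (tensor_mod K H (tensor_mod K H H))
          (\<lambda>x y. pure_tensor K H (tensor_mod K H H) x (\<Delta> y)) (\<Delta> h)"
    and counit_left: "h \<in> carrier H \<Longrightarrow> tensor_lift K H (\<lambda>x y. \<epsilon> x \<odot>\<^bsub>H\<^esub> y) (\<Delta> h) = h"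
    and counit_right: "h \<in> carrier H \<Longrightarrow> tensor_lift K H (\<lambda>x y. \<epsilon> y \<odot>\<^bsub>H\<^esub> x) (\<Delta> h) = h"
    and comult_mult:
      "\<lbrakk>g \<in> carrier H; h \<in> carrier H\<rbrakk> \<Longrightarrow> \<Delta> (g \<otimes>\<^bsub>H\<^esub> h) = \<Delta> g \<otimes>\<^bsub>tensor_alg K H H\<^esub> \<Delta> h"
    and comult_one: "\<Delta> \<one>\<^bsub>H\<^esub> = \<one>\<^bsub>tensor_alg K H H\<^esub>"
    and antipode_lin: "S \<in> lin_maps K H H"
    and antipode_left:
      "h \<in> carrier H \<Longrightarrow> tensor_lift K H (\<lambda>x y. S x \<otimes>\<^bsub>H\<^esub> y) (\<Delta> h) = \<epsilon> h \<odot>\<^bsub>H\<^esub> \<one>\<^bsub>H\<^esub>"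
    and antipode_right:
      "h \<in> carrier H \<Longrightarrow> tensor_lift K H (\<lambda>x y. x \<otimes>\<^bsub>H\<^esub> S y) (\<Delta> h) = \<epsilon> h \<odot>\<^bsub>H\<^esub> \<one>\<^bsub>H\<^esub>"

locale left_hopf_module_algebra =
  Hopf?: hopf_algebra K H \<Delta> \<epsilon> S + Alg?: assoc_algebra K A
  for K (structure) and H (structure) and \<Delta> \<epsilon> S and A (structure) +
  fixes act :: "'c \<Rightarrow> 'e \<Rightarrow> 'e"
  assumes act_lin_right: "h \<in> carrier H \<Longrightarrow> act h \<in> lin_maps K A A"
    and act_lin_left: "a \<in> carrier A \<Longrightarrow> (\<lambda>h. act h a) \<in> lin_maps K H A"
    and act_one: "a \<in> carrier A \<Longrightarrow> act \<one>\<^bsub>H\<^esub> a = a"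
    and act_mult:
      "\<lbrakk>g \<in> carrier H; h \<in> carrier H; a \<in> carrier A\<rbrakk> \<Longrightarrow> act (g \<otimes>\<^bsub>H\<^esub> h) a = act g (act h a)"
    and act_alg_mult:
      "\<lbrakk>h \<in> carrier H; a \<in> carrier A; b \<in> carrier A\<rbrakk> \<Longrightarrow>
        act h (a \<otimes>\<^bsub>A\<^esub> b) = tensor_lift K A (\<lambda>x y. act x a \<otimes>\<^bsub>A\<^esub> act y b) (\<Delta> h)"
    and act_alg_one: "h \<in> carrier H \<Longrightarrow> act h \<one>\<^bsub>A\<^esub> = \<epsilon> h \<odot>\<^bsub>A\<^esub> \<one>\<^bsub>A\<^esub>"

text \<open>
  The coaction makes \<open>A\<close> a right comodule algebra over the opposite algebra of \<open>H\<close>, whence the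
  reversed product in the second leg of \<open>coact_mult\<close>.
\<close>

locale yetter_drinfeld_algebra = left_hopf_module_algebra K H \<Delta> \<epsilon> S A act
  for K (structure) and H (structure) and \<Delta> \<epsilon> S and A (structure) and act +
  fixes \<rho> :: "'e \<Rightarrow> ('e \<times> 'c \<Rightarrow> 'a) set"
  assumes coact_lin: "\<rho> \<in> lin_maps K A (tensor_mod K A H)"
    and coact_coassoc:
      "a \<in> carrier A \<Longrightarrow>
        tensor_assoc K A H H
          (tensor_lift K (tensor_mod K (tensor_mod K A H) H)
             (\<lambda>x y. pure_tensor K (tensor_mod K A H) H (\<rho> x) y) (\<rho> a)) =
        tensor_lift K (tensor_mod K A (tensor_mod K H H))
          (\<lambda>x y. pure_tensor K A (tensor_mod K H H) x (\<Delta> y)) (\<rho> a)"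
    and coact_counit: "a \<in> carrier A \<Longrightarrow> tensor_lift K A (\<lambda>x y. \<epsilon> y \<odot>\<^bsub>A\<^esub> x) (\<rho> a) = a"
    and coact_mult:
      "\<lbrakk>a \<in> carrier A; b \<in> carrier A\<rbrakk> \<Longrightarrow>
        \<rho> (a \<otimes>\<^bsub>A\<^esub> b) =
        tensor_lift K (tensor_mod K A H)
          (\<lambda>a0 a1. tensor_lift K (tensor_mod K A H)
             (\<lambda>b0 b1. pure_tensor K A H (a0 \<otimes>\<^bsub>A\<^esub> b0) (b1 \<otimes>\<^bsub>H\<^esub> a1)) (\<rho> b)) (\<rho> a)"
    and coact_one: "\<rho> \<one>\<^bsub>A\<^esub> = pure_tensor K A H \<one>\<^bsub>A\<^esub> \<one>\<^bsub>H\<^esub>"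
    and yetter_drinfeld:
      "\<lbrakk>h \<in> carrier H; a \<in> carrier A\<rbrakk> \<Longrightarrow>
        tensor_lift K (tensor_mod K A H)
          (\<lambda>h0 h1. tensor_lift K (tensor_mod K A H)
             (\<lambda>x y. pure_tensor K A H x (y \<otimes>\<^bsub>H\<^esub> h0)) (\<rho> (act h1 a))) (\<Delta> h) =
        tensor_lift K (tensor_mod K A H)
          (\<lambda>h0 h1. tensor_lift K (tensor_mod K A H)
             (\<lambda>x y. pure_tensor K A H (act h0 x) (h1 \<otimes>\<^bsub>H\<^esub> y)) (\<rho> a)) (\<Delta> h)"

definition braided_tensor_alg ::
  "('k, 'x) ring_scheme \<Rightarrow> ('k, 'a, 'y) module_scheme \<Rightarrow> ('a \<Rightarrow> ('a \<times> 'h \<Rightarrow> 'k) set)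
    \<Rightarrow> ('k, 'b, 'z) module_scheme \<Rightarrow> ('h \<Rightarrow> 'b \<Rightarrow> 'b)
    \<Rightarrow> ('k, ('a \<times> 'b \<Rightarrow> 'k) set) module" where
  "braided_tensor_alg K A \<rho> B actB = (let T = tensor_mod K A B in
     T\<lparr>mult := (\<lambda>s t.
          tensor_lift K T (\<lambda>a b.
            tensor_lift K T (\<lambda>c d.
              tensor_lift K T (\<lambda>c0 c1.
                pure_tensor K A B (a \<otimes>\<^bsub>A\<^esub> c0) (actB c1 b \<otimes>\<^bsub>B\<^esub> d)) (\<rho> c)) t) s),
       one := pure_tensor K A B \<one>\<^bsub>A\<^esub> \<one>\<^bsub>B\<^esub>\<rparr>)"

definition diagonal_act ::
  "('k, 'x) ring_scheme \<Rightarrow> ('h \<Rightarrow> ('h \<times> 'h \<Rightarrow> 'k) set)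
    \<Rightarrow> ('k, 'a, 'y) module_scheme \<Rightarrow> ('h \<Rightarrow> 'a \<Rightarrow> 'a)
    \<Rightarrow> ('k, 'b, 'z) module_scheme \<Rightarrow> ('h \<Rightarrow> 'b \<Rightarrow> 'b)
    \<Rightarrow> 'h \<Rightarrow> ('a \<times> 'b \<Rightarrow> 'k) set \<Rightarrow> ('a \<times> 'b \<Rightarrow> 'k) set" where
  "diagonal_act K \<Delta> A actA B actB h t = (let T = tensor_mod K A B in
     tensor_lift K T (\<lambda>a b.
       tensor_lift K T (\<lambda>h0 h1. pure_tensor K A B (actA h0 a) (actB h1 b)) (\<Delta> h)) t)"

end

theory Submission
  imports Defs
begin

text \<open>
  By the universal property of the tensor product every Sweedler expression is a linear image of
  \<open>\<Delta> h\<close> or \<open>\<rho> a\<close>, so all identities may be checked on pure tensors, and the axioms become rewrite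
  rules for multilinear maps evaluated on Sweedler legs. Associativity holds since both bracketings of
  \<open>(a \<otimes> b)(c \<otimes> d)(e \<otimes> f)\<close> expand to
  \<open>a c\<^sub>0 e\<^sub>0 \<otimes> ((e\<^sub>1 c\<^sub>1) \<cdot> b)(e\<^sub>2 \<cdot> d) f\<close>, by comultiplicativity of the \<open>H\<close>-action on \<open>B\<close> on one side and by
  multiplicativity and coassociativity of \<open>\<rho>\<close> on the other. Acting with \<open>h\<close> on the product
  \<open>(a \<otimes> b)(c \<otimes> d)\<close> gives
  \<open>(h\<^sub>0 \<cdot> a)(h\<^sub>1 \<cdot> c\<^sub>0) \<otimes> ((h\<^sub>2 c\<^sub>1) \<cdot> b)(h\<^sub>3 \<cdot> d)\<close>, and the Yetter--Drinfeld condition for the middle legs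
  \<open>h\<^sub>1, h\<^sub>2\<close> turns it into \<open>(h\<^sub>0 \<cdot> a)(h\<^sub>2 \<cdot> c)\<^sub>0 \<otimes> (((h\<^sub>2 \<cdot> c)\<^sub>1 h\<^sub>1) \<cdot> b)(h\<^sub>3 \<cdot> d)\<close>, which is the product of
  \<open>h\<^sub>0 \<cdot> (a \<otimes> b)\<close> and \<open>h\<^sub>1 \<cdot> (c \<otimes> d)\<close>.
\<close>

section \<open>Linear maps and free modules\<close>

lemma lin_mapsI:
  assumes "\<And>x. x \<in> carrier M \<Longrightarrow> f x \<in> carrier N"
    and "\<And>x y. \<lbrakk>x \<in> carrier M; y \<in> carrier M\<rbrakk> \<Longrightarrow> f (x \<oplus>\<^bsub>M\<^esub> y) = f x \<oplus>\<^bsub>N\<^esub> f y"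
    and "\<And>c x. \<lbrakk>c \<in> carrier K; x \<in> carrier M\<rbrakk> \<Longrightarrow> f (c \<odot>\<^bsub>M\<^esub> x) = c \<odot>\<^bsub>N\<^esub> f x"
  shows "f \<in> lin_maps K M N"
  using assms by (auto simp: lin_maps_def)

lemma lin_maps_closed: "\<lbrakk>f \<in> lin_maps K M N; x \<in> carrier M\<rbrakk> \<Longrightarrow> f x \<in> carrier N"
  and lin_maps_add:
    "\<lbrakk>f \<in> lin_maps K M N; x \<in> carrier M; y \<in> carrier M\<rbrakk> \<Longrightarrow> f (x \<oplus>\<^bsub>M\<^esub> y) = f x \<oplus>\<^bsub>N\<^esub> f y"
  and lin_maps_smult:
    "\<lbrakk>f \<in> lin_maps K M N; c \<in> carrier K; x \<in> carrier M\<rbrakk> \<Longrightarrow> f (c \<odot>\<^bsub>M\<^esub> x) = c \<odot>\<^bsub>N\<^esub> f x"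
  by (auto simp: lin_maps_def)

text \<open>Membership in \<open>lin_maps\<close> inspects a function on the carrier only, and the
  carrier is closed under sums and scalar multiples. The Hopf and module algebra axioms hold only
  for carrier elements, so rewriting a linear map by them goes through this rule.\<close>

lemma lin_maps_cong:
  assumes "module K M" "f \<in> lin_maps K M N" "\<And>x. x \<in> carrier M \<Longrightarrow> f x = g x"
  shows "g \<in> lin_maps K M N"
proof -
  interpret M: module K M by fact
  show ?thesis
    using assms(2) assms(3)[symmetric] by (auto simp: lin_maps_def Pi_iff)
qed

lemma lin_maps_id: "(\<lambda>x. x) \<in> lin_maps K M M"
  by (simp add: lin_maps_def)

lemma lin_maps_comp:
  "\<lbrakk>g \<in> lin_maps K N P; f \<in> lin_maps K M N\<rbrakk> \<Longrightarrow> (\<lambda>x. g (f x)) \<in> lin_maps K M P"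
  by (auto simp: lin_maps_def Pi_iff)

lemma lin_maps_minus:
  assumes "module K M" "module K N" "f \<in> lin_maps K M N" "x \<in> carrier M" "y \<in> carrier M"
  shows "f (x \<ominus>\<^bsub>M\<^esub> y) = f x \<ominus>\<^bsub>N\<^esub> f y"
proof -
  interpret M: module K M by fact
  interpret N: module K N by fact
  \<comment> \<open>\<open>lin_maps\<close> mentions sums and scalars but no inverses, so negation
    is turned into multiplication by minus one.\<close>
  have neg: "\<ominus>\<^bsub>M\<^esub> y = (\<ominus>\<^bsub>K\<^esub> \<one>\<^bsub>K\<^esub>) \<odot>\<^bsub>M\<^esub> y" "\<ominus>\<^bsub>N\<^esub> f y = (\<ominus>\<^bsub>K\<^esub> \<one>\<^bsub>K\<^esub>) \<odot>\<^bsub>N\<^esub> f y"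
    using assms lin_maps_closed[OF assms(3)] by (simp_all add: M.smult_l_minus N.smult_l_minus)
  show ?thesis
    using assms unfolding a_minus_def neg
    by (simp add: lin_maps_add[OF assms(3)] lin_maps_smult[OF assms(3)])
qed

text \<open>\<open>tensor_rel\<close> is the least submodule containing the relators, so a linear
  map kills it as soon as its kernel is a submodule containing them.\<close>

lemma lin_maps_kernel_submodule:
  assumes "module K M" "module K N" "f \<in> lin_maps K M N"
  shows "submodule {x \<in> carrier M. f x = \<zero>\<^bsub>N\<^esub>} K M"
proof -
  interpret M: module K M by fact
  interpret N: module K N by fact
  note f = assms(3)
  have z: "f \<zero>\<^bsub>M\<^esub> = \<zero>\<^bsub>N\<^esub>"
    using lin_maps_smult[OF f, of "\<zero>\<^bsub>K\<^esub>" "\<zero>\<^bsub>M\<^esub>"] lin_maps_closed[OF f, of "\<zero>\<^bsub>M\<^esub>"]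
    by simp
  show ?thesis
  proof (rule M.submoduleI)
    fix a assume a: "a \<in> {x \<in> carrier M. f x = \<zero>\<^bsub>N\<^esub>}"
    have "\<ominus>\<^bsub>M\<^esub> a = \<zero>\<^bsub>M\<^esub> \<ominus>\<^bsub>M\<^esub> a"
      using a by (simp add: a_minus_def)
    then show "\<ominus>\<^bsub>M\<^esub> a \<in> {x \<in> carrier M. f x = \<zero>\<^bsub>N\<^esub>}"
      using a z by (simp add: lin_maps_minus[OF assms] N.minus_eq)
  qed (use z in \<open>auto simp: lin_maps_add[OF f] lin_maps_smult[OF f]\<close>)
qed

text \<open>Curried, to match the functions taken by \<open>tensor_lift\<close>, and split into two
  families of elements of \<open>lin_maps\<close>, so that bilinearity is checked one variable at a
  time.\<close>

definition bilin_maps ::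
  "('k, 'x) ring_scheme \<Rightarrow> ('k, 'a, 'y) module_scheme \<Rightarrow> ('k, 'b, 'z) module_scheme
    \<Rightarrow> ('k, 'c, 'w) module_scheme \<Rightarrow> ('a \<Rightarrow> 'b \<Rightarrow> 'c) set" where
  "bilin_maps K M N P =
    {f. (\<forall>n\<in>carrier N. (\<lambda>m. f m n) \<in> lin_maps K M P) \<and> (\<forall>m\<in>carrier M. f m \<in> lin_maps K N P)}"

lemma bilin_mapsI:
  assumes "\<And>n. n \<in> carrier N \<Longrightarrow> (\<lambda>m. f m n) \<in> lin_maps K M P"
    and "\<And>m. m \<in> carrier M \<Longrightarrow> (\<lambda>n. f m n) \<in> lin_maps K N P"
  shows "f \<in> bilin_maps K M N P"
  using assms by (auto simp: bilin_maps_def)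

lemma bilin_maps_left: "\<lbrakk>f \<in> bilin_maps K M N P; n \<in> carrier N\<rbrakk> \<Longrightarrow> (\<lambda>m. f m n) \<in> lin_maps K M P"
  and bilin_maps_right: "\<lbrakk>f \<in> bilin_maps K M N P; m \<in> carrier M\<rbrakk> \<Longrightarrow> f m \<in> lin_maps K N P"
  by (auto simp: bilin_maps_def)

lemma bilin_maps_closed:
  "\<lbrakk>f \<in> bilin_maps K M N P; m \<in> carrier M; n \<in> carrier N\<rbrakk> \<Longrightarrow> f m n \<in> carrier P"
  by (auto intro: lin_maps_closed bilin_maps_right)

section \<open>Free modules and the evaluation of formal sums\<close>

lemma module_free_mod:
  assumes "cring K"
  shows "module K (free_mod K I)"
proof -
  interpret cring K by fact
  \<comment> \<open>The operations are pointwise, so the point to check is finiteness of supports: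
    that of a sum lies in the union of the two supports, those of a scalar multiple and of a
    negative in the original one.\<close>
  have add: "finite {i. f i \<oplus>\<^bsub>K\<^esub> g i \<noteq> \<zero>\<^bsub>K\<^esub>}"
    if "finite {i. f i \<noteq> \<zero>\<^bsub>K\<^esub>}" "finite {i. g i \<noteq> \<zero>\<^bsub>K\<^esub>}" "\<forall>i. f i \<in> carrier K" "\<forall>i. g i \<in> carrier K"
    for f g :: "'c \<Rightarrow> 'a"
    by (rule finite_subset[OF _ finite_UnI[OF that(1,2)]]) (use that in auto)
  have smult: "finite {i. c \<otimes>\<^bsub>K\<^esub> f i \<noteq> \<zero>\<^bsub>K\<^esub>}"
    if "finite {i. f i \<noteq> \<zero>\<^bsub>K\<^esub>}" "c \<in> carrier K" for f :: "'c \<Rightarrow> 'a" and c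
    by (rule finite_subset[OF _ that(1)]) (use that in auto)
  have neg: "\<exists>g. ((\<forall>i. g i \<in> carrier K) \<and> finite {i. g i \<noteq> \<zero>\<^bsub>K\<^esub>} \<and> (\<forall>i. i \<notin> I \<longrightarrow> g i = \<zero>\<^bsub>K\<^esub>))
       \<and> (\<lambda>i. f i \<oplus>\<^bsub>K\<^esub> g i) = (\<lambda>_. \<zero>\<^bsub>K\<^esub>)"
    if "finite {i. f i \<noteq> \<zero>\<^bsub>K\<^esub>}" "\<forall>i. f i \<in> carrier K" "\<forall>i. i \<notin> I \<longrightarrow> f i = \<zero>\<^bsub>K\<^esub>" for f :: "'c \<Rightarrow> 'a"
    using that
    by (intro exI[of _ "\<lambda>i. \<ominus>\<^bsub>K\<^esub> f i"] conjI finite_subset[OF _ that(1)]) (auto simp: r_neg)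
  show ?thesis
  proof (rule moduleI)
    show "abelian_group (free_mod K I)"
      by (rule abelian_groupI)
        (auto simp: free_mod_def a_ac intro!: add neg[simplified conj_assoc])
  qed (auto simp: free_mod_def smult l_distr r_distr m_assoc is_cring)
qed

lemma free_gen_closed:
  assumes "cring K" "i \<in> I"
  shows "free_gen K i \<in> carrier (free_mod K I)"
proof -
  interpret cring K by fact
  show ?thesis using assms(2) by (auto simp: free_gen_def free_mod_def)
qed

text \<open>The linear extension of \<open>\<phi>\<close> to formal sums. With \<open>\<phi>\<close>
  the uncurried form of a bilinear map it is the sum occurring in
  \<open>tensor_lift\<close>.\<close>

definition free_eval ::
  "('k, 'x) ring_scheme \<Rightarrow> ('k, 'c, 'y) module_scheme \<Rightarrow> ('i \<Rightarrow> 'c) \<Rightarrow> ('i \<Rightarrow> 'k) \<Rightarrow> 'c" where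
  "free_eval K P \<phi> x = (\<Oplus>\<^bsub>P\<^esub>i\<in>{i. x i \<noteq> \<zero>\<^bsub>K\<^esub>}. x i \<odot>\<^bsub>P\<^esub> \<phi> i)"

context
  fixes K :: "('k, 'x) ring_scheme" and P :: "('k, 'c, 'y) module_scheme"
    and I :: "'i set" and \<phi> :: "'i \<Rightarrow> 'c"
  assumes P: "module K P" and \<phi>: "\<phi> \<in> I \<rightarrow> carrier P"
begin

interpretation P: module K P by (rule P)

text \<open>Sums and scalar multiples may have smaller supports through cancellation or zero
  divisors, so evaluations have to be compared over a common index set. It stays inside
  \<open>I\<close>, where \<open>\<phi>\<close> is known to take values in the carrier.\<close>

lemma free_eval_superset:
  assumes "x \<in> carrier (free_mod K I)" "finite J" "{i. x i \<noteq> \<zero>\<^bsub>K\<^esub>} \<subseteq> J" "J \<subseteq> I"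
  shows "free_eval K P \<phi> x = (\<Oplus>\<^bsub>P\<^esub>i\<in>J. x i \<odot>\<^bsub>P\<^esub> \<phi> i)"
  unfolding free_eval_def
proof (rule P.add.finprod_mono_neutral_cong_left)
  show "(\<lambda>i. x i \<odot>\<^bsub>P\<^esub> \<phi> i) \<in> J \<rightarrow> carrier P"
    using assms \<phi> by (auto simp: free_mod_def Pi_iff subset_iff)
qed (use assms \<phi> in \<open>auto simp: Pi_iff subset_iff\<close>)

lemma free_eval_lin: "free_eval K P \<phi> \<in> lin_maps K (free_mod K I) P"
proof -
  have I: "{i. x i \<noteq> \<zero>\<^bsub>K\<^esub>} \<subseteq> I" "finite {i. x i \<noteq> \<zero>\<^bsub>K\<^esub>}" "x i \<in> carrier K"
    if "x \<in> carrier (free_mod K I)" for x i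
    using that by (auto simp: free_mod_def)
  interpret F: module K "free_mod K I" by (rule module_free_mod) (rule P.is_cring)
  show ?thesis
  proof (rule lin_mapsI)
    fix x assume x: "x \<in> carrier (free_mod K I)"
    show "free_eval K P \<phi> x \<in> carrier P"
      unfolding free_eval_def by (rule P.finsum_closed) (use I[OF x] \<phi> in auto)
  next
    fix x y assume xy: "x \<in> carrier (free_mod K I)" "y \<in> carrier (free_mod K I)"
    define J where "J = {i. x i \<noteq> \<zero>\<^bsub>K\<^esub>} \<union> {i. y i \<noteq> \<zero>\<^bsub>K\<^esub>}"
    have J: "finite J" "J \<subseteq> I" "{i. x i \<noteq> \<zero>\<^bsub>K\<^esub>} \<subseteq> J" "{i. y i \<noteq> \<zero>\<^bsub>K\<^esub>} \<subseteq> J"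
      "{i. (x \<oplus>\<^bsub>free_mod K I\<^esub> y) i \<noteq> \<zero>\<^bsub>K\<^esub>} \<subseteq> J"
      using I[OF xy(1)] I[OF xy(2)] by (auto simp: J_def free_mod_def)
    have "free_eval K P \<phi> (x \<oplus>\<^bsub>free_mod K I\<^esub> y)
        = (\<Oplus>\<^bsub>P\<^esub>i\<in>J. x i \<odot>\<^bsub>P\<^esub> \<phi> i \<oplus>\<^bsub>P\<^esub> y i \<odot>\<^bsub>P\<^esub> \<phi> i)"
      unfolding free_eval_superset[OF F.a_closed[OF xy] J(1,5,2)]
      by (rule P.finsum_cong')
        (use I[OF xy(1)] I[OF xy(2)] J \<phi> in \<open>auto simp: free_mod_def P.smult_l_distr Pi_iff subset_iff\<close>)
    also have "\<dots> = free_eval K P \<phi> x \<oplus>\<^bsub>P\<^esub> free_eval K P \<phi> y"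
      unfolding free_eval_superset[OF xy(1) J(1,3,2)] free_eval_superset[OF xy(2) J(1,4,2)]
      by (rule P.finsum_addf) (use I[OF xy(1)] I[OF xy(2)] J \<phi> in \<open>auto simp: Pi_iff subset_iff\<close>)
    finally show "free_eval K P \<phi> (x \<oplus>\<^bsub>free_mod K I\<^esub> y) = free_eval K P \<phi> x \<oplus>\<^bsub>P\<^esub> free_eval K P \<phi> y" .
  next
    fix c x assume c: "c \<in> carrier K" and x: "x \<in> carrier (free_mod K I)"
    have s: "{i. (c \<odot>\<^bsub>free_mod K I\<^esub> x) i \<noteq> \<zero>\<^bsub>K\<^esub>} \<subseteq> {i. x i \<noteq> \<zero>\<^bsub>K\<^esub>}"
      using c by (auto simp: free_mod_def)
    have "free_eval K P \<phi> (c \<odot>\<^bsub>free_mod K I\<^esub> x)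
        = (\<Oplus>\<^bsub>P\<^esub>i\<in>{i. x i \<noteq> \<zero>\<^bsub>K\<^esub>}. c \<odot>\<^bsub>P\<^esub> (x i \<odot>\<^bsub>P\<^esub> \<phi> i))"
      unfolding free_eval_superset[OF F.smult_closed[OF c x] I(2)[OF x] s I(1)[OF x]]
      by (rule P.finsum_cong')
        (use c I[OF x] \<phi> in \<open>auto simp: free_mod_def P.smult_assoc1 Pi_iff subset_iff\<close>)
    also have "\<dots> = c \<odot>\<^bsub>P\<^esub> free_eval K P \<phi> x"
      unfolding free_eval_def
      by (rule P.finsum_smult_ldistr[symmetric]) (use c I[OF x] \<phi> in auto)
    finally show "free_eval K P \<phi> (c \<odot>\<^bsub>free_mod K I\<^esub> x) = c \<odot>\<^bsub>P\<^esub> free_eval K P \<phi> x" .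
  qed
qed

text \<open>The index set \<open>{i}\<close> also covers the zero ring, in which the support of a
  generator is empty.\<close>

lemma free_eval_gen: "i \<in> I \<Longrightarrow> free_eval K P \<phi> (free_gen K i) = \<phi> i"
  using free_eval_superset[of "free_gen K i" "{i}"] free_gen_closed[OF P.is_cring, of i] \<phi>
  by (fastforce simp: free_gen_def Pi_iff split: if_splits)

end

lemma free_mod_induct [consumes 2, case_names zero add]:
  assumes "cring K" and x: "x \<in> carrier (free_mod K I)"
    and zero: "Q \<zero>\<^bsub>free_mod K I\<^esub>"
    and add: "\<And>x c i. \<lbrakk>x \<in> carrier (free_mod K I); Q x; c \<in> carrier K; i \<in> I\<rbrakk>
        \<Longrightarrow> Q (x \<oplus>\<^bsub>free_mod K I\<^esub> c \<odot>\<^bsub>free_mod K I\<^esub> free_gen K i)"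
  shows "Q x"
proof -
  interpret cring K by fact
  have "Q x" if "finite J" "x \<in> carrier (free_mod K I)" "{i. x i \<noteq> \<zero>\<^bsub>K\<^esub>} = J" for x J
    using that
  proof (induction J arbitrary: x rule: finite_induct)
    case empty
    then show ?case using zero by (simp add: free_mod_def fun_eq_iff)
  next
    case (insert j J)
    \<comment> \<open>Erasing the coefficient at \<open>j\<close> leaves an element of support
      \<open>J\<close>, and \<open>x\<close> is recovered by adding \<open>x j\<close> times the
      generator at \<open>j\<close>.\<close>
    let ?y = "x(j := \<zero>\<^bsub>K\<^esub>)"
    have y: "{i. ?y i \<noteq> \<zero>\<^bsub>K\<^esub>} = J"
      using insert by auto
    have yc: "?y \<in> carrier (free_mod K I)"
      using insert y by (auto simp: free_mod_def)
    have j: "j \<in> I" "x j \<in> carrier K"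
      using insert by (auto simp: free_mod_def)
    have "x = ?y \<oplus>\<^bsub>free_mod K I\<^esub> x j \<odot>\<^bsub>free_mod K I\<^esub> free_gen K j"
      using insert.prems by (auto simp: free_mod_def free_gen_def fun_eq_iff)
    then show ?case
      using add[OF yc insert.IH[OF yc y] j(2,1)] by metis
  qed
  then show ?thesis using x by (auto simp: free_mod_def)
qed

section \<open>The universal property of the tensor product\<close>

text \<open>Only modules are assumed, so that either factor may itself be a tensor product, as
  coassociativity requires.\<close>

locale two_modules = M: module K M + N: module K N
  for K :: "('k, 'x) ring_scheme" and M :: "('k, 'a, 'y) module_scheme"
    and N :: "('k, 'b, 'z) module_scheme"
begin

abbreviation "F \<equiv> free_pairs K M N"
abbreviation "U \<equiv> tensor_rel K M N"
abbreviation "T \<equiv> tensor_mod K M N"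

sublocale F: module K F
  by (rule module_free_mod) (rule M.is_cring)

lemma gen_closed: "\<lbrakk>m \<in> carrier M; n \<in> carrier N\<rbrakk> \<Longrightarrow> free_gen K (m, n) \<in> carrier F"
  by (rule free_gen_closed[OF M.is_cring]) simp

lemma bilinear_relators_closed: "bilinear_relators K M N \<subseteq> carrier F"
  unfolding bilinear_relators_def Let_def by (auto simp: gen_closed)

lemma bilinear_relators_sub_tensor_rel: "bilinear_relators K M N \<subseteq> U"
  by (auto simp: tensor_rel_def)

lemma tensor_rel_submodule: "submodule U K F"
proof -
  \<comment> \<open>The family being intersected is nonempty: the whole free module is a member, and
    this bounds the intersection by \<open>carrier F\<close>.\<close>
  have carrier: "carrier F \<in> {V. submodule V K F \<and> bilinear_relators K M N \<subseteq> V}"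
    using bilinear_relators_closed F.carrier_is_submodule by simp
  show ?thesis
  proof (rule F.submoduleI)
    show "U \<subseteq> carrier F"
      using carrier unfolding tensor_rel_def by (rule Inter_lower)
    show "\<zero>\<^bsub>F\<^esub> \<in> U"
      using subgroup.one_closed[OF submodule.axioms(1)] by (fastforce simp: tensor_rel_def)
  qed (auto simp: tensor_rel_def F.submoduleE(3,4,5))
qed

sublocale U: abelian_subgroup U F
  by (rule abelian_subgroupI3)
    (auto simp: additive_subgroup_def submodule.axioms(1)[OF tensor_rel_submodule] F.abelian_group_axioms)

abbreviation tensor_class where "tensor_class x \<equiv> U +>\<^bsub>F\<^esub> x"

lemma tensor_carrierE:
  assumes "t \<in> carrier T"
  obtains x where "x \<in> carrier F" "t = tensor_class x"
  using assms by (auto simp: tensor_mod_def Let_def A_RCOSETS_def')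

lemma tensor_class_closed: "x \<in> carrier F \<Longrightarrow> tensor_class x \<in> carrier T"
  by (auto simp: tensor_mod_def Let_def A_RCOSETS_def')

lemma tensor_class_add:
  "\<lbrakk>x \<in> carrier F; y \<in> carrier F\<rbrakk> \<Longrightarrow> tensor_class x \<oplus>\<^bsub>T\<^esub> tensor_class y = tensor_class (x \<oplus>\<^bsub>F\<^esub> y)"
  by (simp add: tensor_mod_def Let_def U.a_rcos_sum)

lemma tensor_class_eqI:
  assumes "x \<in> carrier F" "y \<in> carrier F" "x \<ominus>\<^bsub>F\<^esub> y \<in> U"
  shows "tensor_class x = tensor_class y"
  by (rule U.a_repr_independence'[symmetric]) (use assms in \<open>simp_all add: U.a_rcos_module a_minus_def\<close>)

text \<open>Scalar multiplication on the quotient is a union over all representatives. They all give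
  the same coset because \<open>U\<close> is closed under \<open>c\<close>, and the union is
  nonempty because \<open>x\<close> lies in its own coset.\<close>

lemma tensor_class_smult:
  assumes c: "c \<in> carrier K" and x: "x \<in> carrier F"
  shows "c \<odot>\<^bsub>T\<^esub> tensor_class x = tensor_class (c \<odot>\<^bsub>F\<^esub> x)"
proof -
  have "tensor_class (c \<odot>\<^bsub>F\<^esub> y) = tensor_class (c \<odot>\<^bsub>F\<^esub> x)" if y: "y \<in> tensor_class x" for y
  proof (rule tensor_class_eqI)
    have yc: "y \<in> carrier F" using U.a_elemrcos_carrier[OF x y] .
    have "c \<odot>\<^bsub>F\<^esub> (y \<oplus>\<^bsub>F\<^esub> \<ominus>\<^bsub>F\<^esub> x) \<in> U"
      by (rule F.submoduleE(4)[OF tensor_rel_submodule c]) (rule U.a_rcos_module_imp[OF x y])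
    then show "c \<odot>\<^bsub>F\<^esub> y \<ominus>\<^bsub>F\<^esub> c \<odot>\<^bsub>F\<^esub> x \<in> U"
      using x c yc by (simp add: F.smult_r_distr F.smult_r_minus a_minus_def)
  qed (use x c U.a_elemrcos_carrier[OF x y] in auto)
  moreover have "x \<in> tensor_class x"
    by (rule U.a_rcos_self[OF x])
  ultimately have "(\<Union>y\<in>tensor_class x. tensor_class (c \<odot>\<^bsub>F\<^esub> y)) = tensor_class (c \<odot>\<^bsub>F\<^esub> x)"
    by blast
  then show ?thesis
    by (simp add: tensor_mod_def Let_def)
qed

lemma tensor_zero: "\<zero>\<^bsub>T\<^esub> = tensor_class \<zero>\<^bsub>F\<^esub>"
  by (simp add: tensor_mod_def Let_def U.a_rcos_const)

lemma tensor_module: "module K T"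
proof (rule moduleI)
  show "abelian_group T"
  proof (rule abelian_groupI)
    fix t assume "t \<in> carrier T"
    then obtain x where x: "x \<in> carrier F" "t = tensor_class x"
      by (rule tensor_carrierE)
    then show "\<exists>s\<in>carrier T. s \<oplus>\<^bsub>T\<^esub> t = \<zero>\<^bsub>T\<^esub>"
      by (intro bexI[of _ "tensor_class (\<ominus>\<^bsub>F\<^esub> x)"])
        (simp_all add: tensor_zero tensor_class_add tensor_class_closed F.l_neg)
  next
    fix r s t assume "r \<in> carrier T" "s \<in> carrier T" "t \<in> carrier T"
    then show "r \<oplus>\<^bsub>T\<^esub> s \<oplus>\<^bsub>T\<^esub> t = r \<oplus>\<^bsub>T\<^esub> (s \<oplus>\<^bsub>T\<^esub> t)"
      by (elim tensor_carrierE) (simp add: tensor_class_add F.a_assoc)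
  next
    fix s t assume "s \<in> carrier T" "t \<in> carrier T"
    then show "s \<oplus>\<^bsub>T\<^esub> t = t \<oplus>\<^bsub>T\<^esub> s" "s \<oplus>\<^bsub>T\<^esub> t \<in> carrier T"
      by (elim tensor_carrierE; simp add: tensor_class_add tensor_class_closed F.a_comm)+
  next
    fix s assume "s \<in> carrier T"
    then show "\<zero>\<^bsub>T\<^esub> \<oplus>\<^bsub>T\<^esub> s = s"
      by (elim tensor_carrierE) (simp add: tensor_zero tensor_class_add)
  qed (simp add: tensor_zero tensor_class_closed)
next
  fix a b s assume "a \<in> carrier K" "b \<in> carrier K" "s \<in> carrier T"
  then show "(a \<oplus>\<^bsub>K\<^esub> b) \<odot>\<^bsub>T\<^esub> s = a \<odot>\<^bsub>T\<^esub> s \<oplus>\<^bsub>T\<^esub> b \<odot>\<^bsub>T\<^esub> s"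
    and "(a \<otimes>\<^bsub>K\<^esub> b) \<odot>\<^bsub>T\<^esub> s = a \<odot>\<^bsub>T\<^esub> (b \<odot>\<^bsub>T\<^esub> s)"
    by (elim tensor_carrierE; simp add: tensor_class_smult tensor_class_add F.smult_l_distr F.smult_assoc1)+
next
  fix a s t assume "a \<in> carrier K" "s \<in> carrier T" "t \<in> carrier T"
  then show "a \<odot>\<^bsub>T\<^esub> (s \<oplus>\<^bsub>T\<^esub> t) = a \<odot>\<^bsub>T\<^esub> s \<oplus>\<^bsub>T\<^esub> a \<odot>\<^bsub>T\<^esub> t"
    by (elim tensor_carrierE) (simp add: tensor_class_smult tensor_class_add F.smult_r_distr)
next
  fix a s assume "a \<in> carrier K" "s \<in> carrier T"
  then show "a \<odot>\<^bsub>T\<^esub> s \<in> carrier T"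
    by (elim tensor_carrierE) (simp add: tensor_class_smult tensor_class_closed)
next
  fix s assume "s \<in> carrier T"
  then show "\<one>\<^bsub>K\<^esub> \<odot>\<^bsub>T\<^esub> s = s"
    by (elim tensor_carrierE) (simp add: tensor_class_smult)
qed (rule M.is_cring)

sublocale T: module K T
  by (rule tensor_module)

lemma pure_tensor_closed:
  "\<lbrakk>m \<in> carrier M; n \<in> carrier N\<rbrakk> \<Longrightarrow> pure_tensor K M N m n \<in> carrier T"
  by (simp add: pure_tensor_def tensor_class_closed gen_closed)

lemma pure_tensor_bilin: "pure_tensor K M N \<in> bilin_maps K M N T"
proof (rule bilin_mapsI; rule lin_mapsI)
  have rel: "r \<in> U" if "r \<in> bilinear_relators K M N" for r
    using that bilinear_relators_sub_tensor_rel by blast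
  \<comment> \<open>Each bilinearity law now reduces to recognising the difference of the two
    representatives as one of the four kinds of relators.\<close>
  note eqI = tensor_class_eqI[OF _ _ rel[unfolded bilinear_relators_def Let_def]]
  {
    fix n m m' assume "n \<in> carrier N" "m \<in> carrier M" "m' \<in> carrier M"
    then show "pure_tensor K M N (m \<oplus>\<^bsub>M\<^esub> m') n = pure_tensor K M N m n \<oplus>\<^bsub>T\<^esub> pure_tensor K M N m' n"
      unfolding pure_tensor_def
      by (subst tensor_class_add) (simp_all add: gen_closed, rule eqI, simp_all add: gen_closed, blast)
  next
    fix n m c assume "n \<in> carrier N" "m \<in> carrier M" "c \<in> carrier K"
    then show "pure_tensor K M N (c \<odot>\<^bsub>M\<^esub> m) n = c \<odot>\<^bsub>T\<^esub> pure_tensor K M N m n"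
      unfolding pure_tensor_def
      by (subst tensor_class_smult) (simp_all add: gen_closed, rule eqI, simp_all add: gen_closed, blast)
  next
    fix n n' m assume "n \<in> carrier N" "m \<in> carrier M" "n' \<in> carrier N"
    then show "pure_tensor K M N m (n \<oplus>\<^bsub>N\<^esub> n') = pure_tensor K M N m n \<oplus>\<^bsub>T\<^esub> pure_tensor K M N m n'"
      unfolding pure_tensor_def
      by (subst tensor_class_add) (simp_all add: gen_closed, rule eqI, simp_all add: gen_closed, blast)
  next
    fix n m c assume "n \<in> carrier N" "m \<in> carrier M" "c \<in> carrier K"
    then show "pure_tensor K M N m (c \<odot>\<^bsub>N\<^esub> n) = c \<odot>\<^bsub>T\<^esub> pure_tensor K M N m n"
      unfolding pure_tensor_def
      by (subst tensor_class_smult) (simp_all add: gen_closed, rule eqI, simp_all add: gen_closed, blast)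
  }
qed (rule pure_tensor_closed; assumption)+

section \<open>Induction on tensors and linear extension of bilinear maps\<close>

lemma tensor_induct [consumes 1, case_names pure add]:
  assumes t: "t \<in> carrier T"
    and pure: "\<And>m n. \<lbrakk>m \<in> carrier M; n \<in> carrier N\<rbrakk> \<Longrightarrow> Q (pure_tensor K M N m n)"
    and add: "\<And>s t. \<lbrakk>s \<in> carrier T; t \<in> carrier T; Q s; Q t\<rbrakk> \<Longrightarrow> Q (s \<oplus>\<^bsub>T\<^esub> t)"
  shows "Q t"
proof -
  \<comment> \<open>A scalar is absorbed into the left factor and zero is the pure tensor of two
    zeros, so the induction needs no separate cases for them.\<close>
  have smult: "c \<odot>\<^bsub>T\<^esub> pure_tensor K M N m n = pure_tensor K M N (c \<odot>\<^bsub>M\<^esub> m) n"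
    if "c \<in> carrier K" "m \<in> carrier M" "n \<in> carrier N" for c m n
    using lin_maps_smult[OF bilin_maps_left[OF pure_tensor_bilin that(3)] that(1,2)] by simp
  have zero_pure: "\<zero>\<^bsub>T\<^esub> = pure_tensor K M N \<zero>\<^bsub>M\<^esub> \<zero>\<^bsub>N\<^esub>"
    using smult[of "\<zero>\<^bsub>K\<^esub>" "\<zero>\<^bsub>M\<^esub>" "\<zero>\<^bsub>N\<^esub>"] by (simp add: pure_tensor_closed)
  obtain x where x: "x \<in> carrier F" "t = tensor_class x"
    using tensor_carrierE[OF t] .
  from M.is_cring x(1) have "Q (tensor_class x)"
  proof (induction x rule: free_mod_induct)
    case zero
    show ?case
      using pure[of "\<zero>\<^bsub>M\<^esub>" "\<zero>\<^bsub>N\<^esub>"] by (simp add: zero_pure tensor_zero[symmetric])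
  next
    case (add x c i)
    obtain m n where i: "i = (m, n)" "m \<in> carrier M" "n \<in> carrier N"
      using add by blast
    have "tensor_class (x \<oplus>\<^bsub>F\<^esub> c \<odot>\<^bsub>F\<^esub> free_gen K i)
        = tensor_class x \<oplus>\<^bsub>T\<^esub> pure_tensor K M N (c \<odot>\<^bsub>M\<^esub> m) n"
      using add i smult[of c m n]
      by (simp add: tensor_class_add[symmetric] tensor_class_smult[symmetric] gen_closed pure_tensor_def)
    then show ?case
      using add i by (simp add: assms(2,3) pure_tensor_closed tensor_class_closed)
  qed
  then show ?thesis using x by simp
qed

text \<open>This justifies the definite description in \<open>tensor_lift\<close>: the linear
  extension of \<open>f\<close> vanishes on the relators, hence on \<open>U\<close>, hence is
  constant on each coset.\<close>

lemma tensor_lift_class: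
  assumes P: "module K P" and f: "f \<in> bilin_maps K M N P" and x: "x \<in> carrier F"
  shows "tensor_lift K P f (tensor_class x) = free_eval K P (\<lambda>p. f (fst p) (snd p)) x"
proof -
  interpret P: module K P by fact
  let ?\<phi> = "\<lambda>p. f (fst p) (snd p)"
  let ?e = "free_eval K P ?\<phi>"
  have \<phi>: "?\<phi> \<in> carrier M \<times> carrier N \<rightarrow> carrier P"
    using bilin_maps_closed[OF f] by auto
  have e: "?e \<in> lin_maps K F P"
    by (rule free_eval_lin[OF P \<phi>])
  have gen: "?e (free_gen K (m, n)) = f m n" if "m \<in> carrier M" "n \<in> carrier N" for m n
    using free_eval_gen[OF P \<phi>, of "(m, n)"] that by simp
  have minus_self: "v \<ominus>\<^bsub>P\<^esub> v = \<zero>\<^bsub>P\<^esub>" if "v \<in> carrier P" for v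
    using that by (simp add: P.minus_eq P.r_neg)
  have "?e r = \<zero>\<^bsub>P\<^esub>" if "r \<in> bilinear_relators K M N" for r
    using that unfolding bilinear_relators_def Let_def
    by (auto simp: lin_maps_minus[OF F.module_axioms P e] lin_maps_add[OF e] lin_maps_smult[OF e]
        gen gen_closed lin_maps_add[OF bilin_maps_left[OF f]] lin_maps_add[OF bilin_maps_right[OF f]]
        lin_maps_smult[OF bilin_maps_left[OF f]] lin_maps_smult[OF bilin_maps_right[OF f]]
        bilin_maps_closed[OF f] minus_self)
  then have "bilinear_relators K M N \<subseteq> {y \<in> carrier F. ?e y = \<zero>\<^bsub>P\<^esub>}"
    using bilinear_relators_closed by auto
  then have ker: "U \<subseteq> {y \<in> carrier F. ?e y = \<zero>\<^bsub>P\<^esub>}"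
    using lin_maps_kernel_submodule[OF F.module_axioms P e] unfolding tensor_rel_def
    by (intro Inter_lower) simp
  have rep: "?e y = ?e x" if y: "y \<in> tensor_class x" for y
  proof -
    have yc: "y \<in> carrier F" using U.a_elemrcos_carrier[OF x y] .
    have "y \<ominus>\<^bsub>F\<^esub> x \<in> U"
      using U.a_rcos_module_imp[OF x y] by (simp add: a_minus_def)
    then have "?e y \<ominus>\<^bsub>P\<^esub> ?e x = \<zero>\<^bsub>P\<^esub>"
      using ker by (auto simp: lin_maps_minus[OF F.module_axioms P e yc x, symmetric])
    then show ?thesis
      using P.add.inv_solve_right'[of "\<zero>\<^bsub>P\<^esub>" "?e y" "?e x"] lin_maps_closed[OF e yc] lin_maps_closed[OF e x]
      by (simp add: P.minus_eq)
  qed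
  show ?thesis
    unfolding tensor_lift_def
  proof (rule the_equality)
    show "\<forall>y\<in>tensor_class x. ?e x = (\<Oplus>\<^bsub>P\<^esub>p\<in>{p. y p \<noteq> \<zero>\<^bsub>K\<^esub>}. y p \<odot>\<^bsub>P\<^esub> f (fst p) (snd p))"
      using rep unfolding free_eval_def by auto
  next
    fix v assume "\<forall>y\<in>tensor_class x. v = (\<Oplus>\<^bsub>P\<^esub>p\<in>{p. y p \<noteq> \<zero>\<^bsub>K\<^esub>}. y p \<odot>\<^bsub>P\<^esub> f (fst p) (snd p))"
    then show "v = ?e x"
      \<comment> \<open>Uniqueness: \<open>x\<close> belongs to its own coset and so already
        determines \<open>v\<close>.\<close>
      using U.a_rcos_self[OF x] unfolding free_eval_def by auto
  qed
qed

lemma tensor_lift_lin: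
  assumes P: "module K P" and f: "f \<in> bilin_maps K M N P"
  shows "tensor_lift K P f \<in> lin_maps K T P"
proof -
  have e: "free_eval K P (\<lambda>p. f (fst p) (snd p)) \<in> lin_maps K F P"
    by (rule free_eval_lin[OF P]) (use bilin_maps_closed[OF f] in auto)
  show ?thesis
    by (rule lin_mapsI)
      (auto elim!: tensor_carrierE simp: tensor_class_add tensor_class_smult
        tensor_lift_class[OF P f] lin_maps_closed[OF e] lin_maps_add[OF e] lin_maps_smult[OF e])
qed

lemma tensor_lift_pure:
  assumes P: "module K P" and f: "f \<in> bilin_maps K M N P"
    and mn: "m \<in> carrier M" "n \<in> carrier N"
  shows "tensor_lift K P f (pure_tensor K M N m n) = f m n"
proof -
  have "(\<lambda>p. f (fst p) (snd p)) \<in> carrier M \<times> carrier N \<rightarrow> carrier P"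
    using bilin_maps_closed[OF f] by auto
  from free_eval_gen[OF P this, of "(m, n)"] show ?thesis
    using mn unfolding pure_tensor_def by (simp add: tensor_lift_class[OF P f] gen_closed)
qed

text \<open>Pure tensors generate the tensor product additively. Identities between Sweedler
  expressions that are linear in a tensor are reduced to pure tensors by this rule.\<close>

lemma tensor_ext:
  assumes "f \<in> lin_maps K T P" "g \<in> lin_maps K T P" "t \<in> carrier T"
    and "\<And>m n. \<lbrakk>m \<in> carrier M; n \<in> carrier N\<rbrakk> \<Longrightarrow> f (pure_tensor K M N m n) = g (pure_tensor K M N m n)"
  shows "f t = g t"
  using assms(3)
proof (induction rule: tensor_induct)
  case (add s t)
  then show ?case
    using lin_maps_add[OF assms(1) add(1,2)] lin_maps_add[OF assms(2) add(1,2)] by simp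
qed (rule assms(4))

end

section \<open>Calculus of Sweedler sums\<close>

lemma module_tensor_mod: "\<lbrakk>module K M; module K N\<rbrakk> \<Longrightarrow> module K (tensor_mod K M N)"
  by (rule two_modules.tensor_module[OF two_modules.intro])

lemma pure_tensor_closed:
  "\<lbrakk>m \<in> carrier M; n \<in> carrier N; module K M; module K N\<rbrakk>
    \<Longrightarrow> pure_tensor K M N m n \<in> carrier (tensor_mod K M N)"
  by (rule two_modules.pure_tensor_closed[OF two_modules.intro])

text \<open>Stated for a composite \<open>f x\<close> instead of a bare variable, so that linearity
  of a nested expression follows layer by layer from the outside in.\<close>

lemma pure_tensor_lin_left:
  "\<lbrakk>f \<in> lin_maps K L M; n \<in> carrier N; module K M; module K N\<rbrakk>
    \<Longrightarrow> (\<lambda>x. pure_tensor K M N (f x) n) \<in> lin_maps K L (tensor_mod K M N)"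
  by (rule lin_maps_comp[OF bilin_maps_left[OF two_modules.pure_tensor_bilin[OF two_modules.intro]]])

lemma pure_tensor_lin_right:
  "\<lbrakk>f \<in> lin_maps K L N; m \<in> carrier M; module K M; module K N\<rbrakk>
    \<Longrightarrow> (\<lambda>x. pure_tensor K M N m (f x)) \<in> lin_maps K L (tensor_mod K M N)"
  by (rule lin_maps_comp[OF bilin_maps_right[OF two_modules.pure_tensor_bilin[OF two_modules.intro]]])

lemma tensor_lift_lin_arg:
  "\<lbrakk>t \<in> lin_maps K L (tensor_mod K M N); f \<in> bilin_maps K M N P; module K M; module K N; module K P\<rbrakk>
    \<Longrightarrow> (\<lambda>x. tensor_lift K P f (t x)) \<in> lin_maps K L P"
  by (rule lin_maps_comp[OF two_modules.tensor_lift_lin[OF two_modules.intro]])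

lemma tensor_lift_closed:
  "\<lbrakk>t \<in> carrier (tensor_mod K M N); f \<in> bilin_maps K M N P; module K M; module K N; module K P\<rbrakk>
    \<Longrightarrow> tensor_lift K P f t \<in> carrier P"
  by (rule lin_maps_closed[OF two_modules.tensor_lift_lin[OF two_modules.intro]])

lemma tensor_lift_add:
  "\<lbrakk>s \<in> carrier (tensor_mod K M N); t \<in> carrier (tensor_mod K M N); f \<in> bilin_maps K M N P;
    module K M; module K N; module K P\<rbrakk>
    \<Longrightarrow> tensor_lift K P f (s \<oplus>\<^bsub>tensor_mod K M N\<^esub> t) = tensor_lift K P f s \<oplus>\<^bsub>P\<^esub> tensor_lift K P f t"
  by (rule lin_maps_add[OF two_modules.tensor_lift_lin[OF two_modules.intro]])

lemma tensor_lift_pure: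
  "\<lbrakk>f \<in> bilin_maps K M N P; m \<in> carrier M; n \<in> carrier N; module K M; module K N; module K P\<rbrakk>
    \<Longrightarrow> tensor_lift K P f (pure_tensor K M N m n) = f m n"
  by (rule two_modules.tensor_lift_pure[OF two_modules.intro])

lemmas tensor_ext = two_modules.tensor_ext[OF two_modules.intro]
lemmas tensor_induct = two_modules.tensor_induct[OF two_modules.intro, consumes 3, case_names pure add]

lemma bilin_maps_cong:
  assumes "f \<in> bilin_maps K M N P" "module K M" "module K N"
    and "\<And>m n. \<lbrakk>m \<in> carrier M; n \<in> carrier N\<rbrakk> \<Longrightarrow> f m n = g m n"
  shows "g \<in> bilin_maps K M N P"
proof (rule bilin_mapsI)
  fix n assume n: "n \<in> carrier N"
  show "(\<lambda>m. g m n) \<in> lin_maps K M P"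
    by (rule lin_maps_cong[OF assms(2) bilin_maps_left[OF assms(1) n]]) (simp add: assms(4) n)
next
  fix m assume m: "m \<in> carrier M"
  show "(\<lambda>n. g m n) \<in> lin_maps K N P"
    by (rule lin_maps_cong[OF assms(3) bilin_maps_right[OF assms(1) m]]) (simp add: assms(4) m)
qed

text \<open>Allows rewriting the summand of a Sweedler sum by laws valid only for carrier elements.
  Bilinearity of \<open>g\<close> is inherited from \<open>f\<close>, and the two lifts agree on
  pure tensors.\<close>

lemma tensor_lift_cong:
  assumes t: "t \<in> carrier (tensor_mod K M N)" and f: "f \<in> bilin_maps K M N P"
    and eq: "\<And>m n. \<lbrakk>m \<in> carrier M; n \<in> carrier N\<rbrakk> \<Longrightarrow> f m n = g m n"
    and mods: "module K M" "module K N" "module K P"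
  shows "tensor_lift K P f t = tensor_lift K P g t"
proof -
  note g = bilin_maps_cong[OF f mods(1,2) eq]
  show ?thesis
    by (rule tensor_ext[OF mods(1,2) two_modules.tensor_lift_lin two_modules.tensor_lift_lin t])
      (simp_all add: two_modules.intro mods f g eq tensor_lift_pure)
qed

text \<open>Here the tensor is fixed and the summand varies, which is what makes an inner Sweedler
  sum linear in the legs of an outer one. Induction on \<open>t\<close>: on a pure tensor the claim
  is \<open>lin\<close>, and linearity survives addition of tensors.\<close>

lemma tensor_lift_lin_param:
  assumes t: "t \<in> carrier (tensor_mod K M N)"
    and bilin: "\<And>x. x \<in> carrier L \<Longrightarrow> f x \<in> bilin_maps K M N P"
    and lin: "\<And>m n. \<lbrakk>m \<in> carrier M; n \<in> carrier N\<rbrakk> \<Longrightarrow> (\<lambda>x. f x m n) \<in> lin_maps K L P"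
    and mods: "module K L" "module K M" "module K N" "module K P"
  shows "(\<lambda>x. tensor_lift K P (f x) t) \<in> lin_maps K L P"
proof -
  interpret L: module K L by fact
  interpret P: module K P by fact
  note lift = tensor_lift_add[OF _ _ bilin mods(2-4)] tensor_lift_closed[OF _ bilin mods(2-4)]
  from mods(2,3) t show ?thesis
  proof (induction t rule: tensor_induct)
    case (pure m n)
    show ?case
      by (rule lin_maps_cong[OF mods(1) lin[OF pure]])
        (simp add: tensor_lift_pure[OF bilin pure mods(2-4)])
  next
    case (add s t)
    show ?case
    proof (rule lin_mapsI)
      fix x y assume xy: "x \<in> carrier L" "y \<in> carrier L"
      then show "tensor_lift K P (f (x \<oplus>\<^bsub>L\<^esub> y)) (s \<oplus>\<^bsub>tensor_mod K M N\<^esub> t) =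
          tensor_lift K P (f x) (s \<oplus>\<^bsub>tensor_mod K M N\<^esub> t) \<oplus>\<^bsub>P\<^esub> tensor_lift K P (f y) (s \<oplus>\<^bsub>tensor_mod K M N\<^esub> t)"
        using add(1,2) lin_maps_add[OF add(3) xy] lin_maps_add[OF add(4) xy]
        by (simp add: lift P.a_ac)
    next
      fix c x assume cx: "c \<in> carrier K" "x \<in> carrier L"
      then show "tensor_lift K P (f (c \<odot>\<^bsub>L\<^esub> x)) (s \<oplus>\<^bsub>tensor_mod K M N\<^esub> t) =
          c \<odot>\<^bsub>P\<^esub> tensor_lift K P (f x) (s \<oplus>\<^bsub>tensor_mod K M N\<^esub> t)"
        using add(1,2) lin_maps_smult[OF add(3) cx] lin_maps_smult[OF add(4) cx]
        by (simp add: lift P.smult_r_distr)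
    qed (use add(1,2) in \<open>simp add: lift\<close>)
  qed
qed

text \<open>Moves a linear map into a Sweedler sum: both sides are linear in \<open>t\<close> and
  agree on pure tensors.\<close>

lemma lin_tensor_lift:
  assumes "g \<in> lin_maps K P Q" and t: "t \<in> carrier (tensor_mod K M N)" and f: "f \<in> bilin_maps K M N P"
    and mods: "module K M" "module K N" "module K P" "module K Q"
  shows "g (tensor_lift K P f t) = tensor_lift K Q (\<lambda>m n. g (f m n)) t"
proof -
  have gf: "(\<lambda>m n. g (f m n)) \<in> bilin_maps K M N Q"
    by (rule bilin_mapsI; rule lin_maps_comp[OF assms(1)])
      (auto intro: bilin_maps_left[OF f] bilin_maps_right[OF f])
  show ?thesis
    by (rule tensor_ext[OF mods(1,2) lin_maps_comp[OF assms(1) two_modules.tensor_lift_lin] two_modules.tensor_lift_lin t])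
      (simp_all add: two_modules.intro mods f gf tensor_lift_pure)
qed

text \<open>Together these decompose a linearity, bilinearity or membership claim along the
  structure of the expression until only the given data remain.\<close>

lemmas tensor_lift_rules =
  bilin_mapsI lin_maps_id tensor_lift_lin_param tensor_lift_lin_arg tensor_lift_closed
  pure_tensor_lin_left pure_tensor_lin_right pure_tensor_closed module_tensor_mod

text \<open>A Fubini rule for independent Sweedler sums. With \<open>t\<close> fixed both sides are
  linear in \<open>s\<close>, and on a pure tensor both collapse to
  \<open>tensor_lift K P (f m n) t\<close>.\<close>

lemma tensor_lift_swap:
  assumes s: "s \<in> carrier (tensor_mod K M N)" and t: "t \<in> carrier (tensor_mod K M' N')"
    and bilin_inner: "\<And>m n. \<lbrakk>m \<in> carrier M; n \<in> carrier N\<rbrakk> \<Longrightarrow> f m n \<in> bilin_maps K M' N' P"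
    and bilin_outer: "\<And>m' n'. \<lbrakk>m' \<in> carrier M'; n' \<in> carrier N'\<rbrakk> \<Longrightarrow> (\<lambda>m n. f m n m' n') \<in> bilin_maps K M N P"
    and mods: "module K M" "module K N" "module K M'" "module K N'" "module K P"
  shows "tensor_lift K P (\<lambda>m n. tensor_lift K P (f m n) t) s =
    tensor_lift K P (\<lambda>m' n'. tensor_lift K P (\<lambda>m n. f m n m' n') s) t"
proof -
  note lin = bilin_maps_left[OF bilin_outer] bilin_maps_right[OF bilin_outer]
    bilin_maps_left[OF bilin_inner] bilin_maps_right[OF bilin_inner]
  have l: "(\<lambda>m n. tensor_lift K P (f m n) t) \<in> bilin_maps K M N P"
    by (assumption | rule tensor_lift_rules t mods bilin_inner lin)+
  show ?thesis
  proof (rule tensor_ext[OF mods(1,2) _ _ s])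
    show "tensor_lift K P (\<lambda>m n. tensor_lift K P (f m n) t) \<in> lin_maps K (tensor_mod K M N) P"
      by (assumption | rule l tensor_lift_rules mods)+
    show "(\<lambda>s. tensor_lift K P (\<lambda>m' n'. tensor_lift K P (\<lambda>m n. f m n m' n') s) t)
        \<in> lin_maps K (tensor_mod K M N) P"
      by (assumption | rule t bilin_outer tensor_lift_rules mods lin)+
  next
    fix m n assume mn: "m \<in> carrier M" "n \<in> carrier N"
    have "tensor_lift K P (\<lambda>m n. tensor_lift K P (f m n) t) (pure_tensor K M N m n) = tensor_lift K P (f m n) t"
      by (rule tensor_lift_pure[OF l mn]) (rule mods)+
    also have "\<dots> = tensor_lift K P (\<lambda>m' n'. tensor_lift K P (\<lambda>m n. f m n m' n') (pure_tensor K M N m n)) t"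
      by (rule tensor_lift_cong[OF t bilin_inner[OF mn]])
        (simp_all add: mods mn tensor_lift_pure[OF bilin_outer])
    finally show "tensor_lift K P (\<lambda>m n. tensor_lift K P (f m n) t) (pure_tensor K M N m n) = \<dots>" .
  qed
qed

text \<open>The case \<open>C = H\<close>, \<open>\<delta> = \<Delta>\<close> is coassociativity of the comultiplication.\<close>

lemma tensor_lift_coassoc:
  assumes c: "c \<in> carrier C"
    and \<delta>: "\<delta> \<in> lin_maps K C (tensor_mod K C H)" and \<Delta>: "\<Delta> \<in> lin_maps K H (tensor_mod K H H)"
    and coassoc: "tensor_assoc K C H H
          (tensor_lift K (tensor_mod K (tensor_mod K C H) H)
             (\<lambda>x y. pure_tensor K (tensor_mod K C H) H (\<delta> x) y) (\<delta> c)) =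
        tensor_lift K (tensor_mod K C (tensor_mod K H H))
          (\<lambda>x y. pure_tensor K C (tensor_mod K H H) x (\<Delta> y)) (\<delta> c)"
    and f1: "\<And>y z. \<lbrakk>y \<in> carrier H; z \<in> carrier H\<rbrakk> \<Longrightarrow> (\<lambda>x. f x y z) \<in> lin_maps K C P"
    and f2: "\<And>x z. \<lbrakk>x \<in> carrier C; z \<in> carrier H\<rbrakk> \<Longrightarrow> (\<lambda>y. f x y z) \<in> lin_maps K H P"
    and f3: "\<And>x y. \<lbrakk>x \<in> carrier C; y \<in> carrier H\<rbrakk> \<Longrightarrow> (\<lambda>z. f x y z) \<in> lin_maps K H P"
    and mods: "module K C" "module K H" "module K P"
  shows "tensor_lift K P (\<lambda>x z. tensor_lift K P (\<lambda>x y. f x y z) (\<delta> x)) (\<delta> c) =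
    tensor_lift K P (\<lambda>x y. tensor_lift K P (f x) (\<Delta> y)) (\<delta> c)"
proof -
  note \<delta>' = lin_maps_comp[OF \<delta>] lin_maps_closed[OF \<delta>]
  note \<Delta>' = lin_maps_comp[OF \<Delta>] lin_maps_closed[OF \<Delta>]
  note rules = f1 f2 f3 c \<delta>' \<Delta>' tensor_lift_rules mods
  let ?T = "tensor_mod K C (tensor_mod K H H)"
  let ?p = "pure_tensor K C (tensor_mod K H H)"
  \<comment> \<open>The linear map on the threefold tensor product induced by the trilinear
    \<open>f\<close>. The claim is the image of \<open>coassoc\<close> under it.\<close>
  let ?\<Phi> = "tensor_lift K P (\<lambda>x s. tensor_lift K P (f x) s)"
  have b: "(\<lambda>x s. tensor_lift K P (f x) s) \<in> bilin_maps K C (tensor_mod K H H) P"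
    by (assumption | rule rules)+
  have \<Phi>: "?\<Phi> \<in> lin_maps K ?T P"
    by (assumption | rule b rules)+
  have \<Phi>_pure: "?\<Phi> (?p x s) = tensor_lift K P (f x) s"
    if "x \<in> carrier C" "s \<in> carrier (tensor_mod K H H)" for x s
    by (rule tensor_lift_pure[OF b that]) (rule rules)+
  \<comment> \<open>The inner half of \<open>tensor_assoc\<close>: with \<open>z\<close> fixed it
    sends the pure tensor of \<open>x\<close> and \<open>y\<close> to the right-bracketed tensor of
    \<open>x\<close>, \<open>y\<close>, \<open>z\<close>.\<close>
  let ?a = "\<lambda>z s. tensor_lift K ?T (\<lambda>x y. ?p x (pure_tensor K H H y z)) s"
  have a: "(\<lambda>s z. ?a z s) \<in> bilin_maps K (tensor_mod K C H) H ?T"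
    by (assumption | rule rules)+
  have assoc: "tensor_assoc K C H H = tensor_lift K ?T (\<lambda>s z. ?a z s)"
    by (simp add: tensor_assoc_def Let_def)
  have "?\<Phi> (tensor_assoc K C H H
          (tensor_lift K (tensor_mod K (tensor_mod K C H) H)
             (\<lambda>x y. pure_tensor K (tensor_mod K C H) H (\<delta> x) y) (\<delta> c)))
      = ?\<Phi> (tensor_lift K ?T (\<lambda>x z. ?a z (\<delta> x)) (\<delta> c))"
  proof (rule arg_cong[of _ _ ?\<Phi>])
    have "tensor_assoc K C H H (tensor_lift K (tensor_mod K (tensor_mod K C H) H)
             (\<lambda>x y. pure_tensor K (tensor_mod K C H) H (\<delta> x) y) (\<delta> c)) =
        tensor_lift K ?T (\<lambda>x z. tensor_assoc K C H H (pure_tensor K (tensor_mod K C H) H (\<delta> x) z)) (\<delta> c)"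
      unfolding assoc
      by (rule lin_tensor_lift) (assumption | rule a rules)+
    also have "\<dots> = tensor_lift K ?T (\<lambda>x z. ?a z (\<delta> x)) (\<delta> c)"
      unfolding assoc
      by (rule tensor_lift_cong) (assumption | rule a rules tensor_lift_pure[OF a])+
    finally show "tensor_assoc K C H H (tensor_lift K (tensor_mod K (tensor_mod K C H) H)
             (\<lambda>x y. pure_tensor K (tensor_mod K C H) H (\<delta> x) y) (\<delta> c)) = \<dots>" .
  qed
  \<comment> \<open>\<open>?\<Phi>\<close> is now moved through both sums until it meets pure
    tensors, where it returns \<open>f x y z\<close>.\<close>
  also have "\<dots> = tensor_lift K P (\<lambda>x z. ?\<Phi> (?a z (\<delta> x))) (\<delta> c)"
    by (rule lin_tensor_lift[OF \<Phi>]) (assumption | rule rules)+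
  also have "\<dots> = tensor_lift K P (\<lambda>x z. tensor_lift K P (\<lambda>x y. ?\<Phi> (?p x (pure_tensor K H H y z))) (\<delta> x)) (\<delta> c)"
    by (rule tensor_lift_cong) (assumption | rule lin_tensor_lift[OF \<Phi>] b rules)+
  also have "\<dots> = tensor_lift K P (\<lambda>x z. tensor_lift K P (\<lambda>x y. f x y z) (\<delta> x)) (\<delta> c)"
  proof (rule tensor_lift_cong)
    fix x z assume xz: "x \<in> carrier C" "z \<in> carrier H"
    show "tensor_lift K P (\<lambda>x y. ?\<Phi> (?p x (pure_tensor K H H y z))) (\<delta> x) = tensor_lift K P (\<lambda>x y. f x y z) (\<delta> x)"
    proof (rule tensor_lift_cong)
      fix x y assume xy: "x \<in> carrier C" "y \<in> carrier H"
      show "?\<Phi> (?p x (pure_tensor K H H y z)) = f x y z"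
        by (subst \<Phi>_pure, (assumption | rule xy xz rules)+, rule tensor_lift_pure)
          (assumption | rule xy xz rules)+
    qed (assumption | rule xz b rules)+
  qed (assumption | rule b rules)+
  finally have left: "?\<Phi> (tensor_assoc K C H H
          (tensor_lift K (tensor_mod K (tensor_mod K C H) H)
             (\<lambda>x y. pure_tensor K (tensor_mod K C H) H (\<delta> x) y) (\<delta> c))) = \<dots>" .
  have "?\<Phi> (tensor_lift K ?T (\<lambda>x y. ?p x (\<Delta> y)) (\<delta> c)) = tensor_lift K P (\<lambda>x y. ?\<Phi> (?p x (\<Delta> y))) (\<delta> c)"
    by (rule lin_tensor_lift[OF \<Phi>]) (assumption | rule rules)+
  also have "\<dots> = tensor_lift K P (\<lambda>x y. tensor_lift K P (f x) (\<Delta> y)) (\<delta> c)"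
    by (rule tensor_lift_cong) (assumption | rule \<Phi>_pure b rules)+
  finally show ?thesis
    using left coassoc by simp
qed

lemma assoc_algebra_mult_lin_left:
  assumes "f \<in> lin_maps K L A" "b \<in> carrier A" "assoc_algebra K A"
  shows "(\<lambda>x. f x \<otimes>\<^bsub>A\<^esub> b) \<in> lin_maps K L A"
proof -
  interpret assoc_algebra K A by fact
  have "(\<lambda>a. a \<otimes>\<^bsub>A\<^esub> b) \<in> lin_maps K A A"
    using assms(2) by (auto intro!: lin_mapsI simp: A.l_distr smult_mult_left)
  then show ?thesis
    by (rule lin_maps_comp[OF _ assms(1)])
qed

lemma assoc_algebra_mult_lin_right:
  assumes "f \<in> lin_maps K L A" "a \<in> carrier A" "assoc_algebra K A"
  shows "(\<lambda>x. a \<otimes>\<^bsub>A\<^esub> f x) \<in> lin_maps K L A"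
proof -
  interpret assoc_algebra K A by fact
  have "(\<lambda>b. a \<otimes>\<^bsub>A\<^esub> b) \<in> lin_maps K A A"
    using assms(2) by (auto intro!: lin_mapsI simp: A.r_distr smult_mult_right)
  then show ?thesis
    by (rule lin_maps_comp[OF _ assms(1)])
qed

lemma assoc_algebra_mult_closed:
  assumes "a \<in> carrier A" "b \<in> carrier A" "assoc_algebra K A"
  shows "a \<otimes>\<^bsub>A\<^esub> b \<in> carrier A"
proof -
  interpret assoc_algebra K A by fact
  show ?thesis using assms(1,2) by (rule A.m_closed)
qed

lemma assoc_algebra_m_assoc:
  assumes "a \<in> carrier A" "b \<in> carrier A" "c \<in> carrier A" "assoc_algebra K A"
  shows "a \<otimes>\<^bsub>A\<^esub> b \<otimes>\<^bsub>A\<^esub> c = a \<otimes>\<^bsub>A\<^esub> (b \<otimes>\<^bsub>A\<^esub> c)"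
proof -
  interpret assoc_algebra K A by fact
  show ?thesis using assms(1-3) by (rule A.m_assoc)
qed

text \<open>Compatibility with scalars rests on commutativity of \<open>K\<close>.\<close>

lemma module_smult_lin:
  assumes "module K M" "c \<in> carrier K"
  shows "(\<lambda>v. c \<odot>\<^bsub>M\<^esub> v) \<in> lin_maps K M M"
proof -
  interpret module K M by fact
  show ?thesis
    using assms(2)
    by (auto intro!: lin_mapsI simp: smult_r_distr smult_assoc1[symmetric] m_comm)
qed

section \<open>A Yetter-Drinfeld algebra and a module algebra over the same Hopf algebra\<close>

locale yetter_drinfeld_pair =
  fixes K :: "('k, 'x) ring_scheme"
    and H :: "('k, 'h, 'y) module_scheme"
    and A :: "('k, 'a, 'z) module_scheme"
    and B :: "('k, 'b, 'w) module_scheme"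
    and \<Delta> :: "'h \<Rightarrow> ('h \<times> 'h \<Rightarrow> 'k) set"
    and \<epsilon> :: "'h \<Rightarrow> 'k"
    and S :: "'h \<Rightarrow> 'h"
    and actA :: "'h \<Rightarrow> 'a \<Rightarrow> 'a"
    and \<rho> :: "'a \<Rightarrow> ('a \<times> 'h \<Rightarrow> 'k) set"
    and actB :: "'h \<Rightarrow> 'b \<Rightarrow> 'b"
  assumes B_module_algebra: "left_hopf_module_algebra K H \<Delta> \<epsilon> S B actB"
    and yetter_drinfeld: "yetter_drinfeld_algebra K H \<Delta> \<epsilon> S A actA \<rho>"
begin

lemma A_module_algebra: "left_hopf_module_algebra K H \<Delta> \<epsilon> S A actA"
  by (rule yetter_drinfeld_algebra.axioms(1)[OF yetter_drinfeld])

lemma hopf: "hopf_algebra K H \<Delta> \<epsilon> S"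
  by (rule left_hopf_module_algebra.axioms(1)[OF A_module_algebra])

lemma algebras: "assoc_algebra K H" "assoc_algebra K A" "assoc_algebra K B"
  by (rule hopf_algebra.axioms(1)[OF hopf] left_hopf_module_algebra.axioms(2)[OF A_module_algebra]
      left_hopf_module_algebra.axioms(2)[OF B_module_algebra])+

lemmas modules = algebras[THEN assoc_algebra.axioms(1)]

lemmas ring_H = algebras(1)[THEN assoc_algebra.axioms(3)]
lemmas ring_A = algebras(2)[THEN assoc_algebra.axioms(3)]
lemmas ring_B = algebras(3)[THEN assoc_algebra.axioms(3)]
lemmas ones_closed = ring_H[THEN ring.ring_simprules(6)] ring_A[THEN ring.ring_simprules(6)]
  ring_B[THEN ring.ring_simprules(6)]

lemmas comult_lin = hopf_algebra.comult_lin[OF hopf]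
lemmas coact_lin = yetter_drinfeld_algebra.coact_lin[OF yetter_drinfeld]
lemmas actA_lin = left_hopf_module_algebra.act_lin_right[OF A_module_algebra]
  left_hopf_module_algebra.act_lin_left[OF A_module_algebra]
lemmas actB_lin = left_hopf_module_algebra.act_lin_right[OF B_module_algebra]
  left_hopf_module_algebra.act_lin_left[OF B_module_algebra]

lemma counit_closed: "h \<in> carrier H \<Longrightarrow> \<epsilon> h \<in> carrier K"
  by (rule ring_hom_closed[OF hopf_algebra.counit_hom[OF hopf]])

lemma counit_smult_lin:
  assumes "module K M" "v \<in> carrier M"
  shows "(\<lambda>h. \<epsilon> h \<odot>\<^bsub>M\<^esub> v) \<in> lin_maps K H M"
proof -
  interpret M: module K M by fact
  show ?thesis
    using assms(2)
    by (auto intro!: lin_mapsI simp: counit_closed ring_hom_add[OF hopf_algebra.counit_hom[OF hopf]]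
        hopf_algebra.counit_smult[OF hopf] M.smult_l_distr M.smult_assoc1)
qed

abbreviation "T \<equiv> tensor_mod K A B"

lemmas mlin =
  tensor_lift_rules assoc_algebra_mult_lin_left assoc_algebra_mult_lin_right assoc_algebra_mult_closed
  lin_maps_comp[OF comult_lin] lin_maps_closed[OF comult_lin]
  lin_maps_comp[OF coact_lin] lin_maps_closed[OF coact_lin]
  lin_maps_comp[OF actA_lin(1)] lin_maps_comp[OF actA_lin(2)] lin_maps_closed[OF actA_lin(1)]
  lin_maps_comp[OF actB_lin(1)] lin_maps_comp[OF actB_lin(2)] lin_maps_closed[OF actB_lin(1)]
  modules algebras ones_closed

lemma comult_coassoc:
  assumes h: "h \<in> carrier H" and P: "module K P"
    and f1: "\<And>y z. \<lbrakk>y \<in> carrier H; z \<in> carrier H\<rbrakk> \<Longrightarrow> (\<lambda>x. f x y z) \<in> lin_maps K H P"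
    and f2: "\<And>x z. \<lbrakk>x \<in> carrier H; z \<in> carrier H\<rbrakk> \<Longrightarrow> (\<lambda>y. f x y z) \<in> lin_maps K H P"
    and f3: "\<And>x y. \<lbrakk>x \<in> carrier H; y \<in> carrier H\<rbrakk> \<Longrightarrow> (\<lambda>z. f x y z) \<in> lin_maps K H P"
  shows "tensor_lift K P (\<lambda>x z. tensor_lift K P (\<lambda>x y. f x y z) (\<Delta> x)) (\<Delta> h) =
    tensor_lift K P (\<lambda>x y. tensor_lift K P (f x) (\<Delta> y)) (\<Delta> h)"
  by (rule tensor_lift_coassoc[OF h comult_lin comult_lin hopf_algebra.comult_coassoc[OF hopf h] f1 f2 f3
        modules(1,1) P])

lemma coact_coassoc:
  assumes a: "a \<in> carrier A" and P: "module K P"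
    and f1: "\<And>y z. \<lbrakk>y \<in> carrier H; z \<in> carrier H\<rbrakk> \<Longrightarrow> (\<lambda>x. f x y z) \<in> lin_maps K A P"
    and f2: "\<And>x z. \<lbrakk>x \<in> carrier A; z \<in> carrier H\<rbrakk> \<Longrightarrow> (\<lambda>y. f x y z) \<in> lin_maps K H P"
    and f3: "\<And>x y. \<lbrakk>x \<in> carrier A; y \<in> carrier H\<rbrakk> \<Longrightarrow> (\<lambda>z. f x y z) \<in> lin_maps K H P"
  shows "tensor_lift K P (\<lambda>x z. tensor_lift K P (\<lambda>x y. f x y z) (\<rho> x)) (\<rho> a) =
    tensor_lift K P (\<lambda>x y. tensor_lift K P (f x) (\<Delta> y)) (\<rho> a)"
  by (rule tensor_lift_coassoc[OF a coact_lin comult_lin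
        yetter_drinfeld_algebra.coact_coassoc[OF yetter_drinfeld a] f1 f2 f3 modules(2,1) P])

text \<open>Both sides are \<open>f h\<^sup>(\<^sup>0\<^sup>) h\<^sup>(\<^sup>1\<^sup>) h\<^sup>(\<^sup>2\<^sup>) h\<^sup>(\<^sup>3\<^sup>)\<close>; the bracketing on the right makes the two middle
  legs the comultiplication of a single element.\<close>

lemma comult_coassoc4:
  assumes h: "h \<in> carrier H" and P: "module K P"
    and f: "\<And>x y. \<lbrakk>x \<in> carrier H; y \<in> carrier H\<rbrakk> \<Longrightarrow> f x y \<in> bilin_maps K H H P"
      "\<And>x y. \<lbrakk>x \<in> carrier H; y \<in> carrier H\<rbrakk> \<Longrightarrow> (\<lambda>z w. f z w x y) \<in> bilin_maps K H H P"
  shows "tensor_lift K P (\<lambda>x y. tensor_lift K P (\<lambda>x0 x1. tensor_lift K P (f x0 x1) (\<Delta> y)) (\<Delta> x)) (\<Delta> h) =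
    tensor_lift K P (\<lambda>x y. tensor_lift K P (\<lambda>u v. tensor_lift K P (\<lambda>u0 u1. f x u0 u1 v) (\<Delta> u)) (\<Delta> y)) (\<Delta> h)"
proof -
  note rules = f bilin_maps_left[OF f(1)] bilin_maps_right[OF f(1)] bilin_maps_left[OF f(2)] bilin_maps_right[OF f(2)]
    h P mlin
  \<comment> \<open>Threefold coassociativity with the already split last leg treated as one
    variable: the trilinear function is the sum of \<open>f x0 x1\<close> over
    \<open>\<Delta> y\<close>.\<close>
  have "tensor_lift K P (\<lambda>x y. tensor_lift K P (\<lambda>x0 x1. tensor_lift K P (f x0 x1) (\<Delta> y)) (\<Delta> x)) (\<Delta> h) =
     tensor_lift K P (\<lambda>x y. tensor_lift K P (\<lambda>u v. tensor_lift K P (f x u) (\<Delta> v)) (\<Delta> y)) (\<Delta> h)"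
    by (rule comult_coassoc) (assumption | rule rules)+
  \<comment> \<open>Coassociativity again, read backwards under the outer sum with \<open>x\<close>
    fixed.\<close>
  also have "\<dots> = tensor_lift K P (\<lambda>x y. tensor_lift K P (\<lambda>u v. tensor_lift K P (\<lambda>u0 u1. f x u0 u1 v) (\<Delta> u)) (\<Delta> y)) (\<Delta> h)"
    by (rule tensor_lift_cong) (assumption | rule rules comult_coassoc[symmetric])+
  finally show ?thesis .
qed

section \<open>Structure axioms evaluated under arbitrary bilinear maps\<close>

context
  fixes P :: "('k, 'p, 'v) module_scheme"
  assumes P: "module K P"
begin

text \<open>The product in \<open>tensor_alg\<close> is a double Sweedler sum of pure tensors. The
  linear map induced by \<open>f\<close> passes through both sums and evaluates each
  summand.\<close>

lemma tensor_lift_comult_mult: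
  assumes f: "f \<in> bilin_maps K H H P" and g: "g \<in> carrier H" and h: "h \<in> carrier H"
  shows "tensor_lift K P f (\<Delta> (g \<otimes>\<^bsub>H\<^esub> h)) =
    tensor_lift K P (\<lambda>g0 g1. tensor_lift K P (\<lambda>h0 h1. f (g0 \<otimes>\<^bsub>H\<^esub> h0) (g1 \<otimes>\<^bsub>H\<^esub> h1)) (\<Delta> h)) (\<Delta> g)"
proof -
  note rules = f lin_maps_comp[OF bilin_maps_left[OF f]] lin_maps_comp[OF bilin_maps_right[OF f]] g h P mlin
  let ?T = "tensor_mod K H H"
  let ?p = "\<lambda>g0 g1 h0 h1. pure_tensor K H H (g0 \<otimes>\<^bsub>H\<^esub> h0) (g1 \<otimes>\<^bsub>H\<^esub> h1)"
  have "\<Delta> (g \<otimes>\<^bsub>H\<^esub> h) = tensor_lift K ?T (\<lambda>g0 g1. tensor_lift K ?T (?p g0 g1) (\<Delta> h)) (\<Delta> g)"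
    using hopf_algebra.comult_mult[OF hopf g h] by (simp add: tensor_alg_def Let_def)
  then have "tensor_lift K P f (\<Delta> (g \<otimes>\<^bsub>H\<^esub> h)) =
      tensor_lift K P f (tensor_lift K ?T (\<lambda>g0 g1. tensor_lift K ?T (?p g0 g1) (\<Delta> h)) (\<Delta> g))"
    by simp
  also have "\<dots> = tensor_lift K P (\<lambda>g0 g1. tensor_lift K P f (tensor_lift K ?T (?p g0 g1) (\<Delta> h))) (\<Delta> g)"
    by (rule lin_tensor_lift) (assumption | rule rules)+
  also have "\<dots> = tensor_lift K P (\<lambda>g0 g1. tensor_lift K P (\<lambda>h0 h1. tensor_lift K P f (?p g0 g1 h0 h1)) (\<Delta> h)) (\<Delta> g)"
    by (rule tensor_lift_cong) (assumption | rule lin_tensor_lift rules)+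
  also have "\<dots> = tensor_lift K P (\<lambda>g0 g1. tensor_lift K P (\<lambda>h0 h1. f (g0 \<otimes>\<^bsub>H\<^esub> h0) (g1 \<otimes>\<^bsub>H\<^esub> h1)) (\<Delta> h)) (\<Delta> g)"
    by (rule tensor_lift_cong tensor_lift_pure | assumption | rule rules)+
  finally show ?thesis .
qed

lemma tensor_lift_coact_mult:
  assumes f: "f \<in> bilin_maps K A H P" and a: "a \<in> carrier A" and b: "b \<in> carrier A"
  shows "tensor_lift K P f (\<rho> (a \<otimes>\<^bsub>A\<^esub> b)) =
    tensor_lift K P (\<lambda>a0 a1. tensor_lift K P (\<lambda>b0 b1. f (a0 \<otimes>\<^bsub>A\<^esub> b0) (b1 \<otimes>\<^bsub>H\<^esub> a1)) (\<rho> b)) (\<rho> a)"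
proof -
  note rules = f lin_maps_comp[OF bilin_maps_left[OF f]] lin_maps_comp[OF bilin_maps_right[OF f]] a b P mlin
  let ?T = "tensor_mod K A H"
  let ?p = "\<lambda>a0 a1 b0 b1. pure_tensor K A H (a0 \<otimes>\<^bsub>A\<^esub> b0) (b1 \<otimes>\<^bsub>H\<^esub> a1)"
  have "tensor_lift K P f (\<rho> (a \<otimes>\<^bsub>A\<^esub> b)) =
      tensor_lift K P f (tensor_lift K ?T (\<lambda>a0 a1. tensor_lift K ?T (?p a0 a1) (\<rho> b)) (\<rho> a))"
    by (simp add: yetter_drinfeld_algebra.coact_mult[OF yetter_drinfeld a b])
  also have "\<dots> = tensor_lift K P (\<lambda>a0 a1. tensor_lift K P f (tensor_lift K ?T (?p a0 a1) (\<rho> b))) (\<rho> a)"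
    by (rule lin_tensor_lift) (assumption | rule rules)+
  also have "\<dots> = tensor_lift K P (\<lambda>a0 a1. tensor_lift K P (\<lambda>b0 b1. tensor_lift K P f (?p a0 a1 b0 b1)) (\<rho> b)) (\<rho> a)"
    by (rule tensor_lift_cong) (assumption | rule lin_tensor_lift rules)+
  also have "\<dots> = tensor_lift K P (\<lambda>a0 a1. tensor_lift K P (\<lambda>b0 b1. f (a0 \<otimes>\<^bsub>A\<^esub> b0) (b1 \<otimes>\<^bsub>H\<^esub> a1)) (\<rho> b)) (\<rho> a)"
    by (rule tensor_lift_cong tensor_lift_pure | assumption | rule rules)+
  finally show ?thesis .
qed

lemma tensor_lift_yetter_drinfeld:
  assumes f: "f \<in> bilin_maps K A H P" and h: "h \<in> carrier H" and a: "a \<in> carrier A"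
  shows "tensor_lift K P (\<lambda>h0 h1. tensor_lift K P (\<lambda>x y. f x (y \<otimes>\<^bsub>H\<^esub> h0)) (\<rho> (actA h1 a))) (\<Delta> h) =
    tensor_lift K P (\<lambda>h0 h1. tensor_lift K P (\<lambda>x y. f (actA h0 x) (h1 \<otimes>\<^bsub>H\<^esub> y)) (\<rho> a)) (\<Delta> h)"
proof -
  note rules = f lin_maps_comp[OF bilin_maps_left[OF f]] lin_maps_comp[OF bilin_maps_right[OF f]] a h P mlin
  let ?T = "tensor_mod K A H"
  let ?p = "\<lambda>h0 x y. pure_tensor K A H x (y \<otimes>\<^bsub>H\<^esub> h0)"
  let ?q = "\<lambda>h0 h1 x y. pure_tensor K A H (actA h0 x) (h1 \<otimes>\<^bsub>H\<^esub> y)"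
  \<comment> \<open>The axiom is an equation between tensors. Writing each value of \<open>f\<close>
    as a lift on a pure tensor lets \<open>f\<close> be pulled out of both sums; after the axiom is
    applied it is pushed back in.\<close>
  have "tensor_lift K P (\<lambda>h0 h1. tensor_lift K P (\<lambda>x y. f x (y \<otimes>\<^bsub>H\<^esub> h0)) (\<rho> (actA h1 a))) (\<Delta> h) =
      tensor_lift K P (\<lambda>h0 h1. tensor_lift K P (\<lambda>x y. tensor_lift K P f (?p h0 x y)) (\<rho> (actA h1 a))) (\<Delta> h)"
    by (rule tensor_lift_cong tensor_lift_pure[symmetric] | assumption | rule rules)+
  also have "\<dots> = tensor_lift K P (\<lambda>h0 h1. tensor_lift K P f (tensor_lift K ?T (?p h0) (\<rho> (actA h1 a)))) (\<Delta> h)"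
    by (rule tensor_lift_cong) (assumption | rule lin_tensor_lift[symmetric] rules)+
  also have "\<dots> = tensor_lift K P f (tensor_lift K ?T (\<lambda>h0 h1. tensor_lift K ?T (?p h0) (\<rho> (actA h1 a))) (\<Delta> h))"
    by (rule lin_tensor_lift[symmetric]) (assumption | rule rules)+
  also have "\<dots> = tensor_lift K P f (tensor_lift K ?T (\<lambda>h0 h1. tensor_lift K ?T (?q h0 h1) (\<rho> a)) (\<Delta> h))"
    by (simp add: yetter_drinfeld_algebra.yetter_drinfeld[OF yetter_drinfeld h a])
  also have "\<dots> = tensor_lift K P (\<lambda>h0 h1. tensor_lift K P f (tensor_lift K ?T (?q h0 h1) (\<rho> a))) (\<Delta> h)"
    by (rule lin_tensor_lift) (assumption | rule rules)+
  also have "\<dots> = tensor_lift K P (\<lambda>h0 h1. tensor_lift K P (\<lambda>x y. tensor_lift K P f (?q h0 h1 x y)) (\<rho> a)) (\<Delta> h)"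
    by (rule tensor_lift_cong) (assumption | rule lin_tensor_lift rules)+
  also have "\<dots> = tensor_lift K P (\<lambda>h0 h1. tensor_lift K P (\<lambda>x y. f (actA h0 x) (h1 \<otimes>\<^bsub>H\<^esub> y)) (\<rho> a)) (\<Delta> h)"
    by (rule tensor_lift_cong tensor_lift_pure | assumption | rule rules)+
  finally show ?thesis .
qed

end

end

section \<open>The braided tensor product\<close>

context yetter_drinfeld_pair
begin

text \<open>The product of two pure tensors as a function of four variables. Multilinearity is
  established for this function first, and \<open>braid_mult\<close> extends it to all tensors;
  \<open>diag\<close> plays the same part for the action.\<close>

definition braid :: "'a \<Rightarrow> 'b \<Rightarrow> 'a \<Rightarrow> 'b \<Rightarrow> ('a \<times> 'b \<Rightarrow> 'k) set" where
  "braid a b c d = tensor_lift K T (\<lambda>c0 c1. pure_tensor K A B (a \<otimes>\<^bsub>A\<^esub> c0) (actB c1 b \<otimes>\<^bsub>B\<^esub> d)) (\<rho> c)"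

definition braid_mult :: "('a \<times> 'b \<Rightarrow> 'k) set \<Rightarrow> ('a \<times> 'b \<Rightarrow> 'k) set \<Rightarrow> ('a \<times> 'b \<Rightarrow> 'k) set" where
  "braid_mult s t = tensor_lift K T (\<lambda>a b. tensor_lift K T (braid a b) t) s"

definition diag :: "'h \<Rightarrow> 'a \<Rightarrow> 'b \<Rightarrow> ('a \<times> 'b \<Rightarrow> 'k) set" where
  "diag h a b = tensor_lift K T (\<lambda>h0 h1. pure_tensor K A B (actA h0 a) (actB h1 b)) (\<Delta> h)"

abbreviation "dact \<equiv> diagonal_act K \<Delta> A actA B actB"

lemma dact_eq: "dact h t = tensor_lift K T (diag h) t"
  by (simp add: diagonal_act_def diag_def[abs_def] Let_def)

lemma braid_lin1: "\<lbrakk>b \<in> carrier B; c \<in> carrier A; d \<in> carrier B\<rbrakk> \<Longrightarrow> (\<lambda>a. braid a b c d) \<in> lin_maps K A T"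
  and braid_lin2: "\<lbrakk>a \<in> carrier A; c \<in> carrier A; d \<in> carrier B\<rbrakk> \<Longrightarrow> (\<lambda>b. braid a b c d) \<in> lin_maps K B T"
  and braid_lin3: "\<lbrakk>a \<in> carrier A; b \<in> carrier B; d \<in> carrier B\<rbrakk> \<Longrightarrow> (\<lambda>c. braid a b c d) \<in> lin_maps K A T"
  and braid_lin4: "\<lbrakk>a \<in> carrier A; b \<in> carrier B; c \<in> carrier A\<rbrakk> \<Longrightarrow> (\<lambda>d. braid a b c d) \<in> lin_maps K B T"
  unfolding braid_def by (assumption | rule mlin)+

lemma diag_lin1: "\<lbrakk>a \<in> carrier A; b \<in> carrier B\<rbrakk> \<Longrightarrow> (\<lambda>h. diag h a b) \<in> lin_maps K H T"
  and diag_lin2: "\<lbrakk>h \<in> carrier H; b \<in> carrier B\<rbrakk> \<Longrightarrow> (\<lambda>a. diag h a b) \<in> lin_maps K A T"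
  and diag_lin3: "\<lbrakk>h \<in> carrier H; a \<in> carrier A\<rbrakk> \<Longrightarrow> (\<lambda>b. diag h a b) \<in> lin_maps K B T"
  unfolding diag_def by (assumption | rule mlin)+

lemmas mlin' = mlin
  lin_maps_comp[OF braid_lin1] lin_maps_comp[OF braid_lin2] lin_maps_comp[OF braid_lin3]
  lin_maps_comp[OF braid_lin4] lin_maps_closed[OF braid_lin1]
  lin_maps_comp[OF diag_lin1] lin_maps_comp[OF diag_lin2] lin_maps_comp[OF diag_lin3]
  lin_maps_closed[OF diag_lin1]

lemma braid_mult_lin_left: "t \<in> carrier T \<Longrightarrow> (\<lambda>s. braid_mult s t) \<in> lin_maps K T T"
  and braid_mult_lin_right: "s \<in> carrier T \<Longrightarrow> (\<lambda>t. braid_mult s t) \<in> lin_maps K T T"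
  unfolding braid_mult_def by (assumption | rule mlin')+

lemma dact_lin_left: "t \<in> carrier T \<Longrightarrow> (\<lambda>h. dact h t) \<in> lin_maps K H T"
  and dact_lin_right: "h \<in> carrier H \<Longrightarrow> (\<lambda>t. dact h t) \<in> lin_maps K T T"
  unfolding dact_eq by (assumption | rule mlin')+

lemmas mult_lin =
  lin_maps_comp[OF braid_mult_lin_left] lin_maps_comp[OF braid_mult_lin_right] lin_maps_closed[OF braid_mult_lin_left]
lemmas act_lin =
  lin_maps_comp[OF dact_lin_left] lin_maps_comp[OF dact_lin_right] lin_maps_closed[OF dact_lin_left]
lemmas rules = mult_lin act_lin mlin'

lemma braid_mult_pure:
  assumes "a \<in> carrier A" "b \<in> carrier B" "c \<in> carrier A" "d \<in> carrier B"
  shows "braid_mult (pure_tensor K A B a b) (pure_tensor K A B c d) = braid a b c d"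
proof -
  have "braid_mult (pure_tensor K A B a b) (pure_tensor K A B c d) = tensor_lift K T (braid a b) (pure_tensor K A B c d)"
    unfolding braid_mult_def by (rule tensor_lift_pure) (assumption | rule assms mlin')+
  also have "\<dots> = braid a b c d"
    by (rule tensor_lift_pure) (assumption | rule assms mlin')+
  finally show ?thesis .
qed

lemma dact_pure:
  assumes "h \<in> carrier H" "a \<in> carrier A" "b \<in> carrier B"
  shows "dact h (pure_tensor K A B a b) = diag h a b"
  unfolding dact_eq by (rule tensor_lift_pure) (assumption | rule assms mlin')+

section \<open>Associativity and unit of the braided product\<close>

lemma braid_mult_assoc_pure:
  assumes "a \<in> carrier A" "b \<in> carrier B" "c \<in> carrier A" "d \<in> carrier B" "e \<in> carrier A" "f \<in> carrier B"
  shows "braid_mult (braid a b c d) (pure_tensor K A B e f) = braid_mult (pure_tensor K A B a b) (braid c d e f)"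
proof -
  note rules = assms rules
  let ?p = "pure_tensor K A B"
  \<comment> \<open>The common summand of both bracketings. The slots \<open>x\<close> and
    \<open>y\<close> take the second and third legs of \<open>e\<close>, obtained first by
    comultiplying \<open>e1\<close> and later by a second coaction on \<open>e0\<close>.\<close>
  let ?F = "\<lambda>c0 c1 e0 x y. ?p (a \<otimes>\<^bsub>A\<^esub> (c0 \<otimes>\<^bsub>A\<^esub> e0)) (actB (x \<otimes>\<^bsub>H\<^esub> c1) b \<otimes>\<^bsub>B\<^esub> (actB y d \<otimes>\<^bsub>B\<^esub> f))"
  have "braid_mult (braid a b c d) (?p e f) =
      tensor_lift K T (\<lambda>c0 c1. braid_mult (?p (a \<otimes>\<^bsub>A\<^esub> c0) (actB c1 b \<otimes>\<^bsub>B\<^esub> d)) (?p e f)) (\<rho> c)"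
    unfolding braid_def by (rule lin_tensor_lift[of "\<lambda>s. braid_mult s (?p e f)"]) (assumption | rule rules)+
  also have "\<dots> = tensor_lift K T (\<lambda>c0 c1. tensor_lift K T (\<lambda>e0 e1. tensor_lift K T (?F c0 c1 e0) (\<Delta> e1)) (\<rho> e)) (\<rho> c)"
  proof (rule tensor_lift_cong)
    fix c0 c1 assume c01: "c0 \<in> carrier A" "c1 \<in> carrier H"
    have "braid_mult (?p (a \<otimes>\<^bsub>A\<^esub> c0) (actB c1 b \<otimes>\<^bsub>B\<^esub> d)) (?p e f) = braid (a \<otimes>\<^bsub>A\<^esub> c0) (actB c1 b \<otimes>\<^bsub>B\<^esub> d) e f"
      by (rule braid_mult_pure) (assumption | rule c01 rules)+
    also have "\<dots> = tensor_lift K T (\<lambda>e0 e1. tensor_lift K T (?F c0 c1 e0) (\<Delta> e1)) (\<rho> e)"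
      unfolding braid_def
    proof (rule tensor_lift_cong)
      fix e0 e1 assume e01: "e0 \<in> carrier A" "e1 \<in> carrier H"
      \<comment> \<open>Linear in \<open>v\<close>, so the sum produced by acting on a product in
        \<open>B\<close> can be moved outside.\<close>
      let ?g = "\<lambda>v. ?p (a \<otimes>\<^bsub>A\<^esub> c0 \<otimes>\<^bsub>A\<^esub> e0) (v \<otimes>\<^bsub>B\<^esub> f)"
      have "?g (actB e1 (actB c1 b \<otimes>\<^bsub>B\<^esub> d)) =
          ?g (tensor_lift K B (\<lambda>x y. actB x (actB c1 b) \<otimes>\<^bsub>B\<^esub> actB y d) (\<Delta> e1))"
        by (subst left_hopf_module_algebra.act_alg_mult[OF B_module_algebra]) (assumption | rule refl c01 e01 rules)+
      also have "\<dots> = tensor_lift K T (\<lambda>x y. ?g (actB x (actB c1 b) \<otimes>\<^bsub>B\<^esub> actB y d)) (\<Delta> e1)"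
        by (rule lin_tensor_lift[of ?g]) (assumption | rule c01 e01 rules)+
      also have "\<dots> = tensor_lift K T (?F c0 c1 e0) (\<Delta> e1)"
      proof (rule tensor_lift_cong)
        fix x y assume xy: "x \<in> carrier H" "y \<in> carrier H"
        have "a \<otimes>\<^bsub>A\<^esub> c0 \<otimes>\<^bsub>A\<^esub> e0 = a \<otimes>\<^bsub>A\<^esub> (c0 \<otimes>\<^bsub>A\<^esub> e0)"
          by (rule assoc_algebra_m_assoc) (rule c01 e01 rules)+
        moreover have "actB x (actB c1 b) \<otimes>\<^bsub>B\<^esub> actB y d \<otimes>\<^bsub>B\<^esub> f = actB x (actB c1 b) \<otimes>\<^bsub>B\<^esub> (actB y d \<otimes>\<^bsub>B\<^esub> f)"
          by (rule assoc_algebra_m_assoc) (assumption | rule xy c01 e01 rules)+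
        moreover have "actB x (actB c1 b) = actB (x \<otimes>\<^bsub>H\<^esub> c1) b"
          by (rule left_hopf_module_algebra.act_mult[OF B_module_algebra, symmetric]) (rule xy c01 rules)+
        ultimately show "?g (actB x (actB c1 b) \<otimes>\<^bsub>B\<^esub> actB y d) = ?F c0 c1 e0 x y"
          by simp
      qed (assumption | rule c01 e01 rules)+
      finally show "?g (actB e1 (actB c1 b \<otimes>\<^bsub>B\<^esub> d)) = \<dots>" .
    qed (assumption | rule c01 rules)+
    finally show "braid_mult (?p (a \<otimes>\<^bsub>A\<^esub> c0) (actB c1 b \<otimes>\<^bsub>B\<^esub> d)) (?p e f) = \<dots>" .
  qed (assumption | rule rules)+
  also have "\<dots> = tensor_lift K T (\<lambda>c0 c1. tensor_lift K T (\<lambda>e0 e1. tensor_lift K T (\<lambda>x y. ?F c0 c1 x y e1) (\<rho> e0)) (\<rho> e)) (\<rho> c)"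
    by (rule tensor_lift_cong) (assumption | rule coact_coassoc[symmetric] rules)+
  \<comment> \<open>The other bracketing starts from \<open>braid c d e f\<close>, whose outermost
    sum is over the coaction of \<open>e\<close>.\<close>
  also have "\<dots> = tensor_lift K T (\<lambda>e0 e1. tensor_lift K T (\<lambda>c0 c1. tensor_lift K T (\<lambda>x y. ?F c0 c1 x y e1) (\<rho> e0)) (\<rho> c)) (\<rho> e)"
    by (rule tensor_lift_swap) (assumption | rule rules)+
  also have "\<dots> = tensor_lift K T (\<lambda>e0 e1. braid_mult (?p a b) (?p (c \<otimes>\<^bsub>A\<^esub> e0) (actB e1 d \<otimes>\<^bsub>B\<^esub> f))) (\<rho> e)"
  proof (rule tensor_lift_cong)
    fix e0 e1 assume e01: "e0 \<in> carrier A" "e1 \<in> carrier H"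
    have "braid_mult (?p a b) (?p (c \<otimes>\<^bsub>A\<^esub> e0) (actB e1 d \<otimes>\<^bsub>B\<^esub> f)) = braid a b (c \<otimes>\<^bsub>A\<^esub> e0) (actB e1 d \<otimes>\<^bsub>B\<^esub> f)"
      by (rule braid_mult_pure) (assumption | rule e01 rules)+
    \<comment> \<open>The reversed second leg in the coaction of a product puts the leg of
      \<open>e0\<close> to the left of \<open>c1\<close>, the same order in which successive actions
      on \<open>b\<close> compose in \<open>?F\<close>.\<close>
    also have "\<dots> = tensor_lift K T (\<lambda>c0 c1. tensor_lift K T (\<lambda>x y. ?F c0 c1 x y e1) (\<rho> e0)) (\<rho> c)"
      unfolding braid_def by (rule tensor_lift_coact_mult) (assumption | rule e01 rules)+
    finally show "tensor_lift K T (\<lambda>c0 c1. tensor_lift K T (\<lambda>x y. ?F c0 c1 x y e1) (\<rho> e0)) (\<rho> c) =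
        braid_mult (?p a b) (?p (c \<otimes>\<^bsub>A\<^esub> e0) (actB e1 d \<otimes>\<^bsub>B\<^esub> f))" ..
  qed (assumption | rule rules)+
  also have "\<dots> = braid_mult (?p a b) (braid c d e f)"
    unfolding braid_def by (rule lin_tensor_lift[of "braid_mult (?p a b)", symmetric]) (assumption | rule rules)+
  finally show ?thesis .
qed

lemma braid_mult_assoc:
  assumes "r \<in> carrier T" "s \<in> carrier T" "t \<in> carrier T"
  shows "braid_mult (braid_mult r s) t = braid_mult r (braid_mult s t)"
proof (rule tensor_ext[of K A B "\<lambda>r. braid_mult (braid_mult r s) t" T "\<lambda>r. braid_mult r (braid_mult s t)" r])
  fix a b assume ab: "a \<in> carrier A" "b \<in> carrier B"
  let ?p = "pure_tensor K A B"
  show "braid_mult (braid_mult (?p a b) s) t = braid_mult (?p a b) (braid_mult s t)"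
  proof (rule tensor_ext[of K A B "\<lambda>s. braid_mult (braid_mult (?p a b) s) t" T "\<lambda>s. braid_mult (?p a b) (braid_mult s t)" s])
    fix c d assume cd: "c \<in> carrier A" "d \<in> carrier B"
    show "braid_mult (braid_mult (?p a b) (?p c d)) t = braid_mult (?p a b) (braid_mult (?p c d) t)"
    proof (rule tensor_ext[of K A B "\<lambda>t. braid_mult (braid_mult (?p a b) (?p c d)) t" T "\<lambda>t. braid_mult (?p a b) (braid_mult (?p c d) t)" t])
      fix e f assume "e \<in> carrier A" "f \<in> carrier B"
      then show "braid_mult (braid_mult (?p a b) (?p c d)) (?p e f) = braid_mult (?p a b) (braid_mult (?p c d) (?p e f))"
        using ab cd by (simp add: braid_mult_pure braid_mult_assoc_pure)
    qed (assumption | rule ab cd assms rules)+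
  qed (assumption | rule ab assms rules)+
qed (assumption | rule assms rules)+

text \<open>The leg \<open>c1\<close> acts on the unit of \<open>B\<close> through the counit, and
  the counit axiom of the coaction then restores \<open>c\<close>.\<close>

lemma braid_mult_one_left:
  assumes "t \<in> carrier T"
  shows "braid_mult (pure_tensor K A B \<one>\<^bsub>A\<^esub> \<one>\<^bsub>B\<^esub>) t = t"
proof (rule tensor_ext[of K A B "\<lambda>t. braid_mult (pure_tensor K A B \<one>\<^bsub>A\<^esub> \<one>\<^bsub>B\<^esub>) t" T "\<lambda>t. t" t])
  let ?p = "pure_tensor K A B"
  fix c d assume cd: "c \<in> carrier A" "d \<in> carrier B"
  note rules = cd rules counit_smult_lin module_smult_lin counit_closed
  have "braid_mult (?p \<one>\<^bsub>A\<^esub> \<one>\<^bsub>B\<^esub>) (?p c d) = braid \<one>\<^bsub>A\<^esub> \<one>\<^bsub>B\<^esub> c d"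
    by (rule braid_mult_pure) (assumption | rule rules)+
  also have "\<dots> = tensor_lift K T (\<lambda>c0 c1. ?p (\<epsilon> c1 \<odot>\<^bsub>A\<^esub> c0) d) (\<rho> c)"
    unfolding braid_def
  proof (rule tensor_lift_cong)
    fix c0 c1 assume c01: "c0 \<in> carrier A" "c1 \<in> carrier H"
    interpret assoc_algebra K B by (rule algebras)
    have "actB c1 \<one>\<^bsub>B\<^esub> \<otimes>\<^bsub>B\<^esub> d = \<epsilon> c1 \<odot>\<^bsub>B\<^esub> d"
      using left_hopf_module_algebra.act_alg_one[OF B_module_algebra c01(2)] c01 cd
      by (simp add: smult_mult_left counit_closed)
    \<comment> \<open>The scalar \<open>\<epsilon> c1\<close> crosses from the \<open>B\<close>
      factor to the \<open>A\<close> factor, where the counit axiom can absorb it.\<close>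
    then show "?p (\<one>\<^bsub>A\<^esub> \<otimes>\<^bsub>A\<^esub> c0) (actB c1 \<one>\<^bsub>B\<^esub> \<otimes>\<^bsub>B\<^esub> d) = ?p (\<epsilon> c1 \<odot>\<^bsub>A\<^esub> c0) d"
      using lin_maps_smult[OF pure_tensor_lin_left[OF lin_maps_id cd(2) modules(2,3)] counit_closed[OF c01(2)] c01(1)]
        lin_maps_smult[OF pure_tensor_lin_right[OF lin_maps_id c01(1) modules(2,3)] counit_closed[OF c01(2)] cd(2)]
        ring.ring_simprules(12)[OF ring_A c01(1)]
      by simp
  qed (assumption | rule rules)+
  also have "\<dots> = ?p (tensor_lift K A (\<lambda>x y. \<epsilon> y \<odot>\<^bsub>A\<^esub> x) (\<rho> c)) d"
    by (rule lin_tensor_lift[of "\<lambda>x. ?p x d", symmetric]) (assumption | rule rules)+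
  also have "\<dots> = ?p c d"
    by (simp add: yetter_drinfeld_algebra.coact_counit[OF yetter_drinfeld cd(1)])
  finally show "braid_mult (?p \<one>\<^bsub>A\<^esub> \<one>\<^bsub>B\<^esub>) (?p c d) = ?p c d" .
qed (assumption | rule assms rules)+

lemma braid_mult_one_right:
  assumes "t \<in> carrier T"
  shows "braid_mult t (pure_tensor K A B \<one>\<^bsub>A\<^esub> \<one>\<^bsub>B\<^esub>) = t"
proof (rule tensor_ext[of K A B "\<lambda>t. braid_mult t (pure_tensor K A B \<one>\<^bsub>A\<^esub> \<one>\<^bsub>B\<^esub>)" T "\<lambda>t. t" t])
  let ?p = "pure_tensor K A B"
  fix a b assume ab: "a \<in> carrier A" "b \<in> carrier B"
  interpret A: ring A by (rule ring_A)
  interpret B: ring B by (rule ring_B)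
  have "braid_mult (?p a b) (?p \<one>\<^bsub>A\<^esub> \<one>\<^bsub>B\<^esub>) = braid a b \<one>\<^bsub>A\<^esub> \<one>\<^bsub>B\<^esub>"
    by (rule braid_mult_pure) (assumption | rule ab rules)+
  also have "\<dots> = ?p (a \<otimes>\<^bsub>A\<^esub> \<one>\<^bsub>A\<^esub>) (actB \<one>\<^bsub>H\<^esub> b \<otimes>\<^bsub>B\<^esub> \<one>\<^bsub>B\<^esub>)"
    unfolding braid_def yetter_drinfeld_algebra.coact_one[OF yetter_drinfeld]
    by (rule tensor_lift_pure) (assumption | rule ab rules)+
  also have "\<dots> = ?p a b"
    using ab by (simp add: left_hopf_module_algebra.act_one[OF B_module_algebra])
  finally show "braid_mult (?p a b) (?p \<one>\<^bsub>A\<^esub> \<one>\<^bsub>B\<^esub>) = ?p a b" .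
qed (assumption | rule assms rules)+

section \<open>Module axioms for the diagonal action\<close>

lemma dact_one:
  assumes "t \<in> carrier T"
  shows "dact \<one>\<^bsub>H\<^esub> t = t"
proof (rule tensor_ext[of K A B "dact \<one>\<^bsub>H\<^esub>" T "\<lambda>t. t" t])
  let ?p = "pure_tensor K A B"
  fix a b assume ab: "a \<in> carrier A" "b \<in> carrier B"
  have one: "\<Delta> \<one>\<^bsub>H\<^esub> = pure_tensor K H H \<one>\<^bsub>H\<^esub> \<one>\<^bsub>H\<^esub>"
    using hopf_algebra.comult_one[OF hopf] by (simp add: tensor_alg_def Let_def)
  have "dact \<one>\<^bsub>H\<^esub> (?p a b) = diag \<one>\<^bsub>H\<^esub> a b"
    by (rule dact_pure) (rule ab rules)+
  also have "\<dots> = ?p (actA \<one>\<^bsub>H\<^esub> a) (actB \<one>\<^bsub>H\<^esub> b)"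
    unfolding diag_def one by (rule tensor_lift_pure) (assumption | rule ab rules)+
  finally show "dact \<one>\<^bsub>H\<^esub> (?p a b) = ?p a b"
    using ab by (simp add: left_hopf_module_algebra.act_one[OF A_module_algebra]
        left_hopf_module_algebra.act_one[OF B_module_algebra])
qed (assumption | rule assms rules)+

lemma dact_mult:
  assumes gh: "g \<in> carrier H" "h \<in> carrier H" and t: "t \<in> carrier T"
  shows "dact (g \<otimes>\<^bsub>H\<^esub> h) t = dact g (dact h t)"
proof (rule tensor_ext[of K A B "dact (g \<otimes>\<^bsub>H\<^esub> h)" T "\<lambda>t. dact g (dact h t)" t])
  let ?p = "pure_tensor K A B"
  fix a b assume ab: "a \<in> carrier A" "b \<in> carrier B"
  note rules = ab gh rules
  have "dact (g \<otimes>\<^bsub>H\<^esub> h) (?p a b) = diag (g \<otimes>\<^bsub>H\<^esub> h) a b"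
    by (rule dact_pure) (assumption | rule rules)+
  also have "\<dots> = tensor_lift K T (\<lambda>g0 g1. tensor_lift K T
      (\<lambda>h0 h1. ?p (actA (g0 \<otimes>\<^bsub>H\<^esub> h0) a) (actB (g1 \<otimes>\<^bsub>H\<^esub> h1) b)) (\<Delta> h)) (\<Delta> g)"
    unfolding diag_def by (rule tensor_lift_comult_mult) (assumption | rule rules)+
  \<comment> \<open>With the sum over \<open>g\<close> innermost, each summand over \<open>h\<close>
    becomes \<open>g\<close> acting on a pure tensor.\<close>
  also have "\<dots> = tensor_lift K T (\<lambda>h0 h1. tensor_lift K T
      (\<lambda>g0 g1. ?p (actA (g0 \<otimes>\<^bsub>H\<^esub> h0) a) (actB (g1 \<otimes>\<^bsub>H\<^esub> h1) b)) (\<Delta> g)) (\<Delta> h)"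
    by (rule tensor_lift_swap) (assumption | rule rules)+
  also have "\<dots> = tensor_lift K T (\<lambda>h0 h1. dact g (?p (actA h0 a) (actB h1 b))) (\<Delta> h)"
  proof (rule tensor_lift_cong)
    fix h0 h1 assume h01: "h0 \<in> carrier H" "h1 \<in> carrier H"
    have "tensor_lift K T (\<lambda>g0 g1. ?p (actA (g0 \<otimes>\<^bsub>H\<^esub> h0) a) (actB (g1 \<otimes>\<^bsub>H\<^esub> h1) b)) (\<Delta> g) = diag g (actA h0 a) (actB h1 b)"
      unfolding diag_def
    proof (rule tensor_lift_cong)
      fix g0 g1 assume "g0 \<in> carrier H" "g1 \<in> carrier H"
      then show "?p (actA (g0 \<otimes>\<^bsub>H\<^esub> h0) a) (actB (g1 \<otimes>\<^bsub>H\<^esub> h1) b) = ?p (actA g0 (actA h0 a)) (actB g1 (actB h1 b))"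
        using ab h01 by (simp add: left_hopf_module_algebra.act_mult[OF A_module_algebra]
            left_hopf_module_algebra.act_mult[OF B_module_algebra])
    qed (assumption | rule h01 rules)+
    also have "\<dots> = dact g (?p (actA h0 a) (actB h1 b))"
      by (rule dact_pure[symmetric]) (assumption | rule h01 rules)+
    finally show "tensor_lift K T (\<lambda>g0 g1. ?p (actA (g0 \<otimes>\<^bsub>H\<^esub> h0) a) (actB (g1 \<otimes>\<^bsub>H\<^esub> h1) b)) (\<Delta> g) = \<dots>" .
  qed (assumption | rule rules)+
  also have "\<dots> = dact g (diag h a b)"
    unfolding diag_def by (rule lin_tensor_lift[of "dact g", symmetric]) (assumption | rule rules)+
  also have "\<dots> = dact g (dact h (?p a b))"
    using ab gh by (simp add: dact_pure)
  finally show "dact (g \<otimes>\<^bsub>H\<^esub> h) (?p a b) = dact g (dact h (?p a b))" .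
qed (assumption | rule gh t rules)+

lemma dact_alg_one:
  assumes h: "h \<in> carrier H"
  shows "dact h (pure_tensor K A B \<one>\<^bsub>A\<^esub> \<one>\<^bsub>B\<^esub>) = \<epsilon> h \<odot>\<^bsub>T\<^esub> pure_tensor K A B \<one>\<^bsub>A\<^esub> \<one>\<^bsub>B\<^esub>"
proof -
  let ?p = "pure_tensor K A B"
  let ?u = "?p \<one>\<^bsub>A\<^esub> \<one>\<^bsub>B\<^esub>"
  note rules = h rules counit_smult_lin module_smult_lin counit_closed lin_maps_comp[OF counit_smult_lin]
    lin_maps_closed[OF module_smult_lin]
  interpret T: module K T by (rule rules)+
  have u: "?u \<in> carrier T" by (rule rules)+
  have "dact h ?u = diag h \<one>\<^bsub>A\<^esub> \<one>\<^bsub>B\<^esub>"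
    by (rule dact_pure) (rule rules)+
  \<comment> \<open>The product of the scalars \<open>\<epsilon> x\<close> and
    \<open>\<epsilon> y\<close> is written as one value of \<open>\<epsilon>\<close>, so that
    \<open>\<epsilon>\<close> can be pulled out and the counit axiom of \<open>H\<close> applied
    inside it.\<close>
  also have "\<dots> = tensor_lift K T (\<lambda>x y. \<epsilon> (\<epsilon> x \<odot>\<^bsub>H\<^esub> y) \<odot>\<^bsub>T\<^esub> ?u) (\<Delta> h)"
    unfolding diag_def
  proof (rule tensor_lift_cong)
    fix x y assume xy: "x \<in> carrier H" "y \<in> carrier H"
    have "?p (actA x \<one>\<^bsub>A\<^esub>) (actB y \<one>\<^bsub>B\<^esub>) = ?p (\<epsilon> x \<odot>\<^bsub>A\<^esub> \<one>\<^bsub>A\<^esub>) (\<epsilon> y \<odot>\<^bsub>B\<^esub> \<one>\<^bsub>B\<^esub>)"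
      using xy by (simp add: left_hopf_module_algebra.act_alg_one[OF A_module_algebra]
          left_hopf_module_algebra.act_alg_one[OF B_module_algebra])
    also have "\<dots> = \<epsilon> x \<odot>\<^bsub>T\<^esub> ?p \<one>\<^bsub>A\<^esub> (\<epsilon> y \<odot>\<^bsub>B\<^esub> \<one>\<^bsub>B\<^esub>)"
      by (rule lin_maps_smult[OF pure_tensor_lin_left[OF lin_maps_id]]) (assumption | rule xy rules)+
    also have "?p \<one>\<^bsub>A\<^esub> (\<epsilon> y \<odot>\<^bsub>B\<^esub> \<one>\<^bsub>B\<^esub>) = \<epsilon> y \<odot>\<^bsub>T\<^esub> ?u"
      by (rule lin_maps_smult[OF pure_tensor_lin_right[OF lin_maps_id]]) (assumption | rule xy rules)+
    also have "\<epsilon> x \<odot>\<^bsub>T\<^esub> (\<epsilon> y \<odot>\<^bsub>T\<^esub> ?u) = \<epsilon> (\<epsilon> x \<odot>\<^bsub>H\<^esub> y) \<odot>\<^bsub>T\<^esub> ?u"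
      using xy u by (simp add: hopf_algebra.counit_smult[OF hopf] T.smult_assoc1 counit_closed)
    finally show "?p (actA x \<one>\<^bsub>A\<^esub>) (actB y \<one>\<^bsub>B\<^esub>) = \<epsilon> (\<epsilon> x \<odot>\<^bsub>H\<^esub> y) \<odot>\<^bsub>T\<^esub> ?u" .
  qed (assumption | rule rules)+
  also have "\<dots> = \<epsilon> (tensor_lift K H (\<lambda>x y. \<epsilon> x \<odot>\<^bsub>H\<^esub> y) (\<Delta> h)) \<odot>\<^bsub>T\<^esub> ?u"
    by (rule lin_tensor_lift[of "\<lambda>v. \<epsilon> v \<odot>\<^bsub>T\<^esub> ?u", symmetric]) (assumption | rule rules)+
  also have "\<dots> = \<epsilon> h \<odot>\<^bsub>T\<^esub> ?u"
    by (simp add: hopf_algebra.counit_left[OF hopf h])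
  finally show ?thesis .
qed

section \<open>Compatibility of the diagonal action with the braided product\<close>

lemma dact_braid:
  assumes h: "h \<in> carrier H" and abcd: "a \<in> carrier A" "b \<in> carrier B" "c \<in> carrier A" "d \<in> carrier B"
  shows "dact h (braid a b c d) = tensor_lift K T (\<lambda>x y. braid_mult (diag x a b) (diag y c d)) (\<Delta> h)"
proof -
  note rules = h abcd rules
  let ?p = "pure_tensor K A B"
  \<comment> \<open>The outer legs \<open>x\<close> and \<open>v\<close> of \<open>h\<close> are
    parameters; as a function of \<open>p\<close> and \<open>r\<close> this is the bilinear map to
    which the Yetter-Drinfeld condition is applied. \<open>?L\<close> and \<open>?R\<close> are its
    values on the two sides of that condition.\<close>
  let ?G = "\<lambda>x v p r. ?p (actA x a \<otimes>\<^bsub>A\<^esub> p) (actB r b \<otimes>\<^bsub>B\<^esub> actB v d)"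
  let ?L = "\<lambda>x0 x1 y0 y1 c0 c1. ?G x0 y1 (actA x1 c0) (y0 \<otimes>\<^bsub>H\<^esub> c1)"
  let ?R = "\<lambda>x0 x1 y0 y1 p q. ?G x0 y1 p (q \<otimes>\<^bsub>H\<^esub> x1)"
  have "dact h (braid a b c d) =
      tensor_lift K T (\<lambda>c0 c1. dact h (?p (a \<otimes>\<^bsub>A\<^esub> c0) (actB c1 b \<otimes>\<^bsub>B\<^esub> d))) (\<rho> c)"
    unfolding braid_def by (rule lin_tensor_lift[of "dact h"]) (assumption | rule rules)+
  also have "\<dots> = tensor_lift K T (\<lambda>c0 c1. tensor_lift K T (\<lambda>x y. tensor_lift K T (\<lambda>x0 x1.
      tensor_lift K T (\<lambda>y0 y1. ?L x0 x1 y0 y1 c0 c1) (\<Delta> y)) (\<Delta> x)) (\<Delta> h)) (\<rho> c)"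
  proof (rule tensor_lift_cong)
    fix c0 c1 assume c01: "c0 \<in> carrier A" "c1 \<in> carrier H"
    note rules = c01 rules
    have "dact h (?p (a \<otimes>\<^bsub>A\<^esub> c0) (actB c1 b \<otimes>\<^bsub>B\<^esub> d)) = diag h (a \<otimes>\<^bsub>A\<^esub> c0) (actB c1 b \<otimes>\<^bsub>B\<^esub> d)"
      by (rule dact_pure) (assumption | rule rules)+
    also have "\<dots> = tensor_lift K T (\<lambda>x y. tensor_lift K T (\<lambda>x0 x1.
      tensor_lift K T (\<lambda>y0 y1. ?L x0 x1 y0 y1 c0 c1) (\<Delta> y)) (\<Delta> x)) (\<Delta> h)"
      unfolding diag_def
    proof (rule tensor_lift_cong)
      fix x y assume xy: "x \<in> carrier H" "y \<in> carrier H"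
      note rules = xy rules
      let ?bd = "\<lambda>y0 y1. actB (y0 \<otimes>\<^bsub>H\<^esub> c1) b \<otimes>\<^bsub>B\<^esub> actB y1 d"
      let ?ac = "\<lambda>x0 x1. actA x0 a \<otimes>\<^bsub>A\<^esub> actA x1 c0"
      have actA: "actA x (a \<otimes>\<^bsub>A\<^esub> c0) = tensor_lift K A ?ac (\<Delta> x)"
        by (rule left_hopf_module_algebra.act_alg_mult[OF A_module_algebra]) (rule rules)+
      have "actB y (actB c1 b \<otimes>\<^bsub>B\<^esub> d) = tensor_lift K B (\<lambda>y0 y1. actB y0 (actB c1 b) \<otimes>\<^bsub>B\<^esub> actB y1 d) (\<Delta> y)"
        by (rule left_hopf_module_algebra.act_alg_mult[OF B_module_algebra]) (rule rules)+
      also have "\<dots> = tensor_lift K B ?bd (\<Delta> y)"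
        by (rule tensor_lift_cong)
          (assumption | rule rules arg_cong2[of _ _ _ _ "mult B"] refl
            left_hopf_module_algebra.act_mult[OF B_module_algebra, symmetric])+
      finally have "?p (actA x (a \<otimes>\<^bsub>A\<^esub> c0)) (actB y (actB c1 b \<otimes>\<^bsub>B\<^esub> d)) =
          ?p (tensor_lift K A ?ac (\<Delta> x)) (tensor_lift K B ?bd (\<Delta> y))"
        using actA by simp
      also have "\<dots> = tensor_lift K T (\<lambda>x0 x1. ?p (?ac x0 x1) (tensor_lift K B ?bd (\<Delta> y))) (\<Delta> x)"
        by (rule lin_tensor_lift[of "\<lambda>v. ?p v (tensor_lift K B ?bd (\<Delta> y))"]) (assumption | rule rules)+
      also have "\<dots> = tensor_lift K T (\<lambda>x0 x1. tensor_lift K T (\<lambda>y0 y1. ?L x0 x1 y0 y1 c0 c1) (\<Delta> y)) (\<Delta> x)"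
      proof (rule tensor_lift_cong)
        fix x0 x1 assume x01: "x0 \<in> carrier H" "x1 \<in> carrier H"
        show "?p (?ac x0 x1) (tensor_lift K B ?bd (\<Delta> y)) = tensor_lift K T (\<lambda>y0 y1. ?L x0 x1 y0 y1 c0 c1) (\<Delta> y)"
          by (rule lin_tensor_lift[of "?p (?ac x0 x1)"]) (assumption | rule x01 rules)+
      qed (assumption | rule rules)+
      finally show "?p (actA x (a \<otimes>\<^bsub>A\<^esub> c0)) (actB y (actB c1 b \<otimes>\<^bsub>B\<^esub> d)) = \<dots>" .
    qed (assumption | rule rules)+
    finally show "dact h (?p (a \<otimes>\<^bsub>A\<^esub> c0) (actB c1 b \<otimes>\<^bsub>B\<^esub> d)) = \<dots>" .
  qed (assumption | rule rules)+
  \<comment> \<open>Rebracketing makes the two middle legs of \<open>h\<close> the comultiplication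
    of a single element \<open>u\<close>.\<close>
  also have "\<dots> = tensor_lift K T (\<lambda>c0 c1. tensor_lift K T (\<lambda>x y. tensor_lift K T (\<lambda>u v.
      tensor_lift K T (\<lambda>u0 u1. ?L x u0 u1 v c0 c1) (\<Delta> u)) (\<Delta> y)) (\<Delta> h)) (\<rho> c)"
    by (rule tensor_lift_cong) (assumption | rule rules comult_coassoc4)+
  \<comment> \<open>The sum over the coaction of \<open>c\<close> moves inwards past all three
    comultiplications, since the Yetter-Drinfeld condition needs it directly inside the sum over
    \<open>\<Delta> u\<close>.\<close>
  also have "\<dots> = tensor_lift K T (\<lambda>x y. tensor_lift K T (\<lambda>c0 c1. tensor_lift K T (\<lambda>u v.
      tensor_lift K T (\<lambda>u0 u1. ?L x u0 u1 v c0 c1) (\<Delta> u)) (\<Delta> y)) (\<rho> c)) (\<Delta> h)"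
    by (rule tensor_lift_swap) (assumption | rule rules)+
  also have "\<dots> = tensor_lift K T (\<lambda>x y. tensor_lift K T (\<lambda>u v. tensor_lift K T (\<lambda>u0 u1.
      tensor_lift K T (\<lambda>c0 c1. ?L x u0 u1 v c0 c1) (\<rho> c)) (\<Delta> u)) (\<Delta> y)) (\<Delta> h)"
  proof (rule tensor_lift_cong)
    fix x y assume xy: "x \<in> carrier H" "y \<in> carrier H"
    have "tensor_lift K T (\<lambda>c0 c1. tensor_lift K T (\<lambda>u v.
        tensor_lift K T (\<lambda>u0 u1. ?L x u0 u1 v c0 c1) (\<Delta> u)) (\<Delta> y)) (\<rho> c) =
      tensor_lift K T (\<lambda>u v. tensor_lift K T (\<lambda>c0 c1.
        tensor_lift K T (\<lambda>u0 u1. ?L x u0 u1 v c0 c1) (\<Delta> u)) (\<rho> c)) (\<Delta> y)"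
      by (rule tensor_lift_swap) (assumption | rule xy rules)+
    also have "\<dots> = tensor_lift K T (\<lambda>u v. tensor_lift K T (\<lambda>u0 u1.
      tensor_lift K T (\<lambda>c0 c1. ?L x u0 u1 v c0 c1) (\<rho> c)) (\<Delta> u)) (\<Delta> y)"
      by (rule tensor_lift_cong) (assumption | rule tensor_lift_swap xy rules)+
    finally show "tensor_lift K T (\<lambda>c0 c1. tensor_lift K T (\<lambda>u v.
        tensor_lift K T (\<lambda>u0 u1. ?L x u0 u1 v c0 c1) (\<Delta> u)) (\<Delta> y)) (\<rho> c) = \<dots>" .
  qed (assumption | rule rules)+
  \<comment> \<open>The Yetter-Drinfeld condition for \<open>u\<close> and \<open>c\<close>, read
    from right to left.\<close>
  also have "\<dots> = tensor_lift K T (\<lambda>x y. tensor_lift K T (\<lambda>u v. tensor_lift K T (\<lambda>u0 u1.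
      tensor_lift K T (\<lambda>p q. ?R x u0 u1 v p q) (\<rho> (actA u1 c))) (\<Delta> u)) (\<Delta> y)) (\<Delta> h)"
  proof (rule tensor_lift_cong)
    fix x y assume xy: "x \<in> carrier H" "y \<in> carrier H"
    show "tensor_lift K T (\<lambda>u v. tensor_lift K T (\<lambda>u0 u1.
        tensor_lift K T (\<lambda>c0 c1. ?L x u0 u1 v c0 c1) (\<rho> c)) (\<Delta> u)) (\<Delta> y) =
      tensor_lift K T (\<lambda>u v. tensor_lift K T (\<lambda>u0 u1.
        tensor_lift K T (\<lambda>p q. ?R x u0 u1 v p q) (\<rho> (actA u1 c))) (\<Delta> u)) (\<Delta> y)"
    proof (rule tensor_lift_cong)
      fix u v assume uv: "u \<in> carrier H" "v \<in> carrier H"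
      show "tensor_lift K T (\<lambda>u0 u1. tensor_lift K T (\<lambda>c0 c1. ?L x u0 u1 v c0 c1) (\<rho> c)) (\<Delta> u) =
        tensor_lift K T (\<lambda>u0 u1. tensor_lift K T (\<lambda>p q. ?R x u0 u1 v p q) (\<rho> (actA u1 c))) (\<Delta> u)"
        by (rule tensor_lift_yetter_drinfeld[of T "?G x v", symmetric]) (assumption | rule uv xy rules)+
    qed (assumption | rule xy rules)+
  qed (assumption | rule rules)+
  \<comment> \<open>The four legs are regrouped in pairs: the middle ones become \<open>x1\<close>,
    acting on \<open>b\<close>, and \<open>y0\<close>, acting on \<open>c\<close>.\<close>
  also have "\<dots> = tensor_lift K T (\<lambda>x y. tensor_lift K T (\<lambda>x0 x1. tensor_lift K T (\<lambda>y0 y1.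
      tensor_lift K T (\<lambda>p q. ?R x0 x1 y0 y1 p q) (\<rho> (actA y0 c))) (\<Delta> y)) (\<Delta> x)) (\<Delta> h)"
    by (rule comult_coassoc4[symmetric]) (assumption | rule rules)+
  also have "\<dots> = tensor_lift K T (\<lambda>x y. braid_mult (diag x a b) (diag y c d)) (\<Delta> h)"
  proof (rule tensor_lift_cong)
    fix x y assume xy: "x \<in> carrier H" "y \<in> carrier H"
    note rules = xy rules
    have "braid_mult (diag x a b) (diag y c d) =
        tensor_lift K T (\<lambda>x0 x1. braid_mult (?p (actA x0 a) (actB x1 b)) (diag y c d)) (\<Delta> x)"
      unfolding diag_def[of x] by (rule lin_tensor_lift[of "\<lambda>s. braid_mult s (diag y c d)"]) (assumption | rule rules)+
    also have "\<dots> = tensor_lift K T (\<lambda>x0 x1. tensor_lift K T (\<lambda>y0 y1.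
      tensor_lift K T (\<lambda>p q. ?R x0 x1 y0 y1 p q) (\<rho> (actA y0 c))) (\<Delta> y)) (\<Delta> x)"
    proof (rule tensor_lift_cong)
      fix x0 x1 assume x01: "x0 \<in> carrier H" "x1 \<in> carrier H"
      note rules = x01 rules
      have "braid_mult (?p (actA x0 a) (actB x1 b)) (diag y c d) =
          tensor_lift K T (\<lambda>y0 y1. braid_mult (?p (actA x0 a) (actB x1 b)) (?p (actA y0 c) (actB y1 d))) (\<Delta> y)"
        unfolding diag_def by (rule lin_tensor_lift[of "braid_mult (?p (actA x0 a) (actB x1 b))"]) (assumption | rule rules)+
      also have "\<dots> = tensor_lift K T (\<lambda>y0 y1.
        tensor_lift K T (\<lambda>p q. ?R x0 x1 y0 y1 p q) (\<rho> (actA y0 c))) (\<Delta> y)"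
      proof (rule tensor_lift_cong)
        fix y0 y1 assume y01: "y0 \<in> carrier H" "y1 \<in> carrier H"
        note rules = y01 rules
        have "braid_mult (?p (actA x0 a) (actB x1 b)) (?p (actA y0 c) (actB y1 d)) =
            braid (actA x0 a) (actB x1 b) (actA y0 c) (actB y1 d)"
          by (rule braid_mult_pure) (assumption | rule rules)+
        also have "\<dots> = tensor_lift K T (\<lambda>p q. ?R x0 x1 y0 y1 p q) (\<rho> (actA y0 c))"
          unfolding braid_def
          by (rule tensor_lift_cong)
            (assumption | rule rules arg_cong2[of _ _ _ _ "mult B"] arg_cong[of _ _ "?p (actA x0 a \<otimes>\<^bsub>A\<^esub> _)"] refl
              left_hopf_module_algebra.act_mult[OF B_module_algebra, symmetric])+
        finally show "braid_mult (?p (actA x0 a) (actB x1 b)) (?p (actA y0 c) (actB y1 d)) = \<dots>" .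
      qed (assumption | rule rules)+
      finally show "braid_mult (?p (actA x0 a) (actB x1 b)) (diag y c d) = \<dots>" .
    qed (assumption | rule rules)+
    finally show "tensor_lift K T (\<lambda>x0 x1. tensor_lift K T (\<lambda>y0 y1.
      tensor_lift K T (\<lambda>p q. ?R x0 x1 y0 y1 p q) (\<rho> (actA y0 c))) (\<Delta> y)) (\<Delta> x) =
      braid_mult (diag x a b) (diag y c d)" ..
  qed (assumption | rule rules)+
  finally show ?thesis .
qed

lemma dact_braid_mult:
  assumes h: "h \<in> carrier H" and st: "s \<in> carrier T" "t \<in> carrier T"
  shows "dact h (braid_mult s t) = tensor_lift K T (\<lambda>x y. braid_mult (dact x s) (dact y t)) (\<Delta> h)"
proof (rule tensor_ext[of K A B "\<lambda>s. dact h (braid_mult s t)" T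
      "\<lambda>s. tensor_lift K T (\<lambda>x y. braid_mult (dact x s) (dact y t)) (\<Delta> h)" s])
  let ?p = "pure_tensor K A B"
  fix a b assume ab: "a \<in> carrier A" "b \<in> carrier B"
  show "dact h (braid_mult (?p a b) t) =
      tensor_lift K T (\<lambda>x y. braid_mult (dact x (?p a b)) (dact y t)) (\<Delta> h)"
  proof (rule tensor_ext[of K A B "\<lambda>t. dact h (braid_mult (?p a b) t)" T
        "\<lambda>t. tensor_lift K T (\<lambda>x y. braid_mult (dact x (?p a b)) (dact y t)) (\<Delta> h)" t])
    fix c d assume cd: "c \<in> carrier A" "d \<in> carrier B"
    have "dact h (braid_mult (?p a b) (?p c d)) =
        tensor_lift K T (\<lambda>x y. braid_mult (diag x a b) (diag y c d)) (\<Delta> h)"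
      using h ab cd by (simp add: braid_mult_pure dact_braid)
    also have "\<dots> = tensor_lift K T (\<lambda>x y. braid_mult (dact x (?p a b)) (dact y (?p c d))) (\<Delta> h)"
    proof (rule tensor_lift_cong)
      fix x y assume "x \<in> carrier H" "y \<in> carrier H"
      then show "braid_mult (diag x a b) (diag y c d) = braid_mult (dact x (?p a b)) (dact y (?p c d))"
        using ab cd by (simp add: dact_pure)
    qed (assumption | rule h ab cd rules)+
    finally show "dact h (braid_mult (?p a b) (?p c d)) = \<dots>" .
  qed (assumption | rule h ab st rules)+
qed (assumption | rule h st rules)+

section \<open>Assembling the module algebra\<close>

abbreviation "R \<equiv> braided_tensor_alg K A \<rho> B actB"

lemma braided_tensor_alg_simps:
  "carrier R = carrier T" "add R = add T" "zero R = zero T" "smult R = smult T"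
  "mult R = braid_mult" "one R = pure_tensor K A B \<one>\<^bsub>A\<^esub> \<one>\<^bsub>B\<^esub>"
  by (simp_all add: braided_tensor_alg_def Let_def braid_mult_def[abs_def] braid_def[abs_def])

lemma braided_tensor_alg_lin_maps: "lin_maps K M R = lin_maps K M T" "lin_maps K R M = lin_maps K T M"
  by (simp_all add: lin_maps_def braided_tensor_alg_simps)

text \<open>A finite sum depends on the record only through its additive monoid, which is untouched
  when product and unit are replaced.\<close>

lemma braided_tensor_alg_lift: "tensor_lift K R = tensor_lift K T"
proof -
  have "add_monoid R = add_monoid T"
    by (simp add: braided_tensor_alg_def Let_def)
  then show ?thesis
    unfolding tensor_lift_def[abs_def] finsum_def by (simp only: braided_tensor_alg_simps)
qed

lemma braided_tensor_alg_assoc_algebra: "assoc_algebra K R"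
proof -
  interpret K: field K
    by (rule assoc_algebra.axioms(2)[OF algebras(1)])
  interpret T: module K T
    by (rule rules)+
  have abelian: "abelian_group R"
    by (rule abelian_groupI)
      (auto simp: braided_tensor_alg_simps T.a_ac intro: T.add.l_inv_ex)
  have "module K R"
    by (rule moduleI)
      (simp_all add: K.is_cring abelian braided_tensor_alg_simps T.smult_l_distr T.smult_r_distr T.smult_assoc1)
  moreover have "ring R"
  proof (rule ringI)
    show "Group.monoid R"
      by (rule monoidI)
        (simp_all add: braided_tensor_alg_simps lin_maps_closed[OF braid_mult_lin_left] braid_mult_assoc
          braid_mult_one_left braid_mult_one_right pure_tensor_closed modules ones_closed)
  qed (simp_all add: abelian braided_tensor_alg_simps lin_maps_add[OF braid_mult_lin_left]
      lin_maps_add[OF braid_mult_lin_right])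
  ultimately show ?thesis
    by (intro assoc_algebra.intro assoc_algebra_axioms.intro K.field_axioms)
      (simp_all add: braided_tensor_alg_simps lin_maps_smult[OF braid_mult_lin_left]
        lin_maps_smult[OF braid_mult_lin_right])
qed

lemma braided_tensor_alg_module_algebra: "left_hopf_module_algebra K H \<Delta> \<epsilon> S R dact"
  by (intro left_hopf_module_algebra.intro left_hopf_module_algebra_axioms.intro hopf
      braided_tensor_alg_assoc_algebra)
    (simp_all add: braided_tensor_alg_simps braided_tensor_alg_lin_maps braided_tensor_alg_lift
      dact_lin_left dact_lin_right dact_one dact_mult dact_braid_mult dact_alg_one)

end

text \<open>The last two conjuncts confirm that the encoded product and action have the intended
  values on pure tensors. This is not automatic, since \<open>tensor_lift\<close> is a definite
  description whose value is secured by bilinearity.\<close>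

theorem lemma5p1:
  fixes K :: "('k, 'x) ring_scheme"
    and H :: "('k, 'h, 'y) module_scheme"
    and A :: "('k, 'a, 'z) module_scheme"
    and B :: "('k, 'b, 'w) module_scheme"
    and \<Delta> :: "'h \<Rightarrow> ('h \<times> 'h \<Rightarrow> 'k) set"
    and \<epsilon> :: "'h \<Rightarrow> 'k"
    and S :: "'h \<Rightarrow> 'h"
    and actA :: "'h \<Rightarrow> 'a \<Rightarrow> 'a"
    and \<rho> :: "'a \<Rightarrow> ('a \<times> 'h \<Rightarrow> 'k) set"
    and actB :: "'h \<Rightarrow> 'b \<Rightarrow> 'b"
  assumes "field K"
    and "\<And>n::nat. n > 0 \<Longrightarrow> [n] \<cdot>\<^bsub>K\<^esub> \<one>\<^bsub>K\<^esub> \<noteq> \<zero>\<^bsub>K\<^esub>"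
    and "hopf_algebra K H \<Delta> \<epsilon> S"
    and "bij_betw S (carrier H) (carrier H)"
    and "left_hopf_module_algebra K H \<Delta> \<epsilon> S B actB"
    and "yetter_drinfeld_algebra K H \<Delta> \<epsilon> S A actA \<rho>"
  shows "left_hopf_module_algebra K H \<Delta> \<epsilon> S
           (braided_tensor_alg K A \<rho> B actB) (diagonal_act K \<Delta> A actA B actB) \<and>
         (\<forall>a\<in>carrier A. \<forall>b\<in>carrier B. \<forall>c\<in>carrier A. \<forall>d\<in>carrier B.
           pure_tensor K A B a b \<otimes>\<^bsub>braided_tensor_alg K A \<rho> B actB\<^esub> pure_tensor K A B c d =
           tensor_lift K (tensor_mod K A B)
             (\<lambda>c0 c1. pure_tensor K A B (a \<otimes>\<^bsub>A\<^esub> c0) (actB c1 b \<otimes>\<^bsub>B\<^esub> d)) (\<rho> c)) \<and>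
         (\<forall>h\<in>carrier H. \<forall>a\<in>carrier A. \<forall>b\<in>carrier B.
           diagonal_act K \<Delta> A actA B actB h (pure_tensor K A B a b) =
           tensor_lift K (tensor_mod K A B)
             (\<lambda>h0 h1. pure_tensor K A B (actA h0 a) (actB h1 b)) (\<Delta> h))"
proof -
  interpret yetter_drinfeld_pair K H A B \<Delta> \<epsilon> S actA \<rho> actB
    using assms(5,6) by (rule yetter_drinfeld_pair.intro)
  show ?thesis
    using braided_tensor_alg_module_algebra
    by (simp add: braided_tensor_alg_simps braid_mult_pure dact_pure braid_def diag_def)
qed

end
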